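(* Let $\{S_e : e\in\mathcal{E}\}$ be a strongly connected graph directed iterated function system (GD-IFS) in $\mathbb{R}^d$ with attractor $(K_1,\ldots,K_q)$, such that at least one $K_i$ contains at least two points, and let $j\in\mathcal{V}=\{1,\dots,q\}$. Then for every $\varepsilon>0$ there exists a self-similar iterated function system (SS-IFS) $\{S_i\}_{i=1}^m$ in $\mathbb{R}^d$ that satisfies the strong separation condition, with attractor $K$, such that $K\subseteq K_j$, $\dim_H K_j-\varepsilon<\dim_H K$, and the transformation group $\mathcal{T}$ of $\{S_i\}_{i=1}^m$ is dense in $\mathcal{T}_{j,G}$ (the $j$-th transformation group of the GD-IFS).
   Context: Self-similar systems. An SS-IFS in $\mathbb{R}^d$ is a finite collection $\{S_i\}_{i=1}^m$ of contracting similarities of $\mathbb{R}^d$; write $S_i(x)=r_iT_i(x)+v_i$ with $0<r_i<1$, $T_i\in\mathbb{O}_d$ (the orthogonal group), $v_i\in\mathbb{R}^d$. Its attractor is the unique nonempty compact $K$ with $K=\bigcup_{i=1}^m S_i(K)$. The strong separation condition (SSC) means that the sets $S_1(K),\dots,S_m(K)$ are pairwise disjoint. The transformation group $\mathcal{T}$ is the group generated by $T_1,\dots,T_m$. Graph directed systems. Let $G(\mathcal{V},\mathcal{E})$ be a directed graph with vertex set $\mathcal{V}=\{1,\ldots,q\}$ and finite set $\mathcal{E}$ of directed edges (several edges between two vertices and loops are allowed) such that at least one edge starts from each vertex. $\mathcal{E}_{i,j}$ is the set of edges from $i$ to $j$, and $\mathcal{E}_{i,j}^k$ is the set of sequences $(e_1,\ldots,e_k)$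 of $k$ edges forming a directed path from $i$ to $j$. A GD-IFS in $\mathbb{R}^d$ is a collection $\{S_e:e\in\mathcal{E}\}$ of contracting similarities of $\mathbb{R}^d$; write $S_e(x)=r_eT_e(x)+v_e$ with $0<r_e<1$, $T_e\in\mathbb{O}_d$, $v_e\in\mathbb{R}^d$. Its attractor is the unique $q$-tuple $(K_1,\ldots,K_q)$ of nonempty compact sets with $K_i=\bigcup_{j=1}^q\bigcup_{e\in\mathcal{E}_{i,j}}S_e(K_j)$ for all $i$. It is strongly connected if for every pair of vertices $i,j$ there is a directed path from $i$ to $j$ and one from $j$ to $i$. $\mathcal{C}_j=\bigcup_{k\ge1}\mathcal{E}_{j,j}^k$ is the set of directed cycles starting and ending at $j$, and $\mathcal{T}_{j,G}$, the $j$-th transformation group, is the group generated by $\{T_{e_1}\circ\cdots\circ T_{e_k}:(e_1,\ldots,e_k)\in\mathcal{C}_j\}$. $\dim_H$ is Hausdorff dimension. Density is with respect to the usual topology of $\mathbb{O}_d$; "$\mathcal T$ is dense in $\mathcal T_{j,G}$" means $\mathcal T$ is a dense subset of $\mathcal T_{j,G}$. *)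

theory Defs
  imports
    "HOL-Analysis.Analysis"
    "HOL-Algebra.Generated_Groups"
    "Graph_Theory.Digraph_Component"
begin

section \<open>Hausdorff dimension\<close>

text \<open>
  The contribution of a covering set to the \<open>s\<close>-dimensional Hausdorff sum. The case \<open>s = 0\<close> is
  separate because \<open>0 powr 0 = 0\<close>, whereas a nonempty set has to contribute \<open>1\<close>.
\<close>

definition diam_pow :: "real \<Rightarrow> 'a::metric_space set \<Rightarrow> ennreal" where
  "diam_pow s U =
     (if U = {} then 0 else if s = 0 then 1 else ennreal (diameter U powr s))"

text \<open>
  Countable covers are sequences of sets; finite covers are padded with empty sets.
  Boundedness is explicit because \<^const>\<open>diameter\<close> is unspecified on unbounded sets.
\<close>

definition delta_covers :: "real \<Rightarrow> 'a::metric_space set \<Rightarrow> (nat \<Rightarrow> 'a set) set" where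
  "delta_covers \<delta> A =
     {U. A \<subseteq> (\<Union>i. U i) \<and> (\<forall>i. bounded (U i) \<and> diameter (U i) \<le> \<delta>)}"

definition hausdorff_premeasure :: "real \<Rightarrow> real \<Rightarrow> 'a::metric_space set \<Rightarrow> ennreal" where
  "hausdorff_premeasure s \<delta> A = (INF U\<in>delta_covers \<delta> A. \<Sum>i. diam_pow s (U i))"

definition hausdorff_measure :: "real \<Rightarrow> 'a::metric_space set \<Rightarrow> ennreal" where
  "hausdorff_measure s A = (SUP \<delta>\<in>{0<..}. hausdorff_premeasure s \<delta> A)"

text \<open>
  Restricted to Euclidean spaces, where every \<open>s > DIM('a)\<close> belongs to the set below,
  so that the real infimum is taken over a nonempty set bounded below.
\<close>

definition hausdorff_dim :: "'a::euclidean_space set \<Rightarrow> real" where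
  "hausdorff_dim A = Inf {s. 0 \<le> s \<and> hausdorff_measure s A = 0}"


section \<open>The orthogonal group\<close>

text \<open>
  Orthogonal maps are represented by their matrices; the topology of the orthogonal group is
  the one induced from the type of matrices.
\<close>

definition orthogonal_group :: "(real^'n^'n) monoid" where
  "orthogonal_group = \<lparr>carrier = {A. orthogonal_matrix A}, mult = (**), one = mat 1\<rparr>"

lemma group_orthogonal_group: "group (orthogonal_group :: (real^'n^'n) monoid)"
proof (rule groupI)
  fix A :: "real^'n^'n"
  assume "A \<in> carrier orthogonal_group"
  then show "\<exists>B\<in>carrier orthogonal_group. B \<otimes>\<^bsub>orthogonal_group\<^esub> A = \<one>\<^bsub>orthogonal_group\<^esub>"
    by (intro bexI[of _ "transpose A"])
       (auto simp: orthogonal_group_def orthogonal_matrix_def)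
qed (auto simp: orthogonal_group_def orthogonal_matrix_mul orthogonal_matrix_id matrix_mul_assoc)

definition dense_subset_of :: "'a::topological_space set \<Rightarrow> 'a set \<Rightarrow> bool" where
  "dense_subset_of A B \<longleftrightarrow> A \<subseteq> B \<and> B \<subseteq> closure A"


section \<open>Contracting similarities\<close>

definition similarity_map :: "real \<Rightarrow> real^'n^'n \<Rightarrow> real^'n \<Rightarrow> real^'n \<Rightarrow> real^'n" where
  "similarity_map r T v x = r *\<^sub>R (T *v x) + v"

definition contracting_similarity_data :: "real \<Rightarrow> real^'n^'n \<Rightarrow> bool" where
  "contracting_similarity_data r T \<longleftrightarrow> 0 < r \<and> r < 1 \<and> orthogonal_matrix T"


section \<open>Self-similar iterated function systems\<close>

text \<open>
  A system of \<open>m\<close> maps is given by its ratios \<open>r\<close>, orthogonal parts \<open>T\<close> and translations \<open>v\<close>;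
  only their values on the index set \<open>{1..m}\<close> are relevant.
\<close>

definition ss_ifs :: "nat \<Rightarrow> (nat \<Rightarrow> real) \<Rightarrow> (nat \<Rightarrow> real^'n^'n) \<Rightarrow> bool" where
  "ss_ifs m r T \<longleftrightarrow> (\<forall>i\<in>{1..m}. contracting_similarity_data (r i) (T i))"

definition ss_attractor ::
  "nat \<Rightarrow> (nat \<Rightarrow> real) \<Rightarrow> (nat \<Rightarrow> real^'n^'n) \<Rightarrow> (nat \<Rightarrow> real^'n) \<Rightarrow> (real^'n) set \<Rightarrow> bool" where
  "ss_attractor m r T v K \<longleftrightarrow>
     K \<noteq> {} \<and> compact K \<and> K = (\<Union>i\<in>{1..m}. similarity_map (r i) (T i) (v i) ` K)"

definition strong_separation ::
  "nat \<Rightarrow> (nat \<Rightarrow> real) \<Rightarrow> (nat \<Rightarrow> real^'n^'n) \<Rightarrow> (nat \<Rightarrow> real^'n) \<Rightarrow> (real^'n) set \<Rightarrow> bool" where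
  "strong_separation m r T v K \<longleftrightarrow>
     disjoint_family_on (\<lambda>i. similarity_map (r i) (T i) (v i) ` K) {1..m}"

definition transformation_group :: "nat \<Rightarrow> (nat \<Rightarrow> real^'n^'n) \<Rightarrow> (real^'n^'n) set" where
  "transformation_group m T = generate orthogonal_group (T ` {1..m})"


section \<open>Graph directed iterated function systems\<close>

definition gd_ifs ::
  "nat \<Rightarrow> (nat, 'e) pre_digraph \<Rightarrow> ('e \<Rightarrow> real) \<Rightarrow> ('e \<Rightarrow> real^'n^'n) \<Rightarrow> bool" where
  "gd_ifs q G r T \<longleftrightarrow>
     fin_digraph G \<and> verts G = {1..q} \<and>
     (\<forall>i\<in>verts G. \<exists>e\<in>arcs G. tail G e = i) \<and>
     (\<forall>e\<in>arcs G. contracting_similarity_data (r e) (T e))"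

definition arcs_between :: "('a, 'e) pre_digraph \<Rightarrow> 'a \<Rightarrow> 'a \<Rightarrow> 'e set" where
  "arcs_between G i j = {e \<in> arcs G. tail G e = i \<and> head G e = j}"

definition gd_attractor ::
  "(nat, 'e) pre_digraph \<Rightarrow> ('e \<Rightarrow> real) \<Rightarrow> ('e \<Rightarrow> real^'n^'n) \<Rightarrow> ('e \<Rightarrow> real^'n) \<Rightarrow>
     (nat \<Rightarrow> (real^'n) set) \<Rightarrow> bool" where
  "gd_attractor G r T v K \<longleftrightarrow>
     (\<forall>i\<in>verts G. K i \<noteq> {} \<and> compact (K i) \<and>
        K i = (\<Union>j\<in>verts G. \<Union>e\<in>arcs_between G i j. similarity_map (r e) (T e) (v e) ` K j))"

text \<open>
  Directed cycles may repeat vertices and edges, hence closed walks and not the library's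
  (simple) cycles.
\<close>

definition directed_cycles :: "('a, 'e) pre_digraph \<Rightarrow> 'a \<Rightarrow> 'e list set" where
  "directed_cycles G j = {p. p \<noteq> [] \<and> pre_digraph.awalk G j p j}"

definition path_matrix :: "('e \<Rightarrow> real^'n^'n) \<Rightarrow> 'e list \<Rightarrow> real^'n^'n" where
  "path_matrix T p = foldr (\<lambda>e A. T e ** A) p (mat 1)"

definition gd_transformation_group ::
  "(nat, 'e) pre_digraph \<Rightarrow> ('e \<Rightarrow> real^'n^'n) \<Rightarrow> nat \<Rightarrow> (real^'n^'n) set" where
  "gd_transformation_group G T j =
     generate orthogonal_group (path_matrix T ` directed_cycles G j)"

end

theory Submission
  imports Defs
begin

text \<open>
  Every finite nonempty set \<open>W\<close> of directed cycles at \<open>j\<close> gives a self-similar set inside \<open>K j\<close>: the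
  map \<open>S p\<close> along a cycle \<open>p\<close> sends \<open>K j\<close> into itself, so the maps \<open>S p\<close> for \<open>p \<in> W\<close> have an
  attractor inside \<open>K j\<close>, which is strongly separated as soon as the cylinders \<open>S p ` K j\<close> are pairwise
  disjoint. Such a \<open>W\<close> has to be large enough for the dimension and rich enough for the group.

  \<^emph>\<open>Dimension.\<close> At scale \<open>\<delta>\<close>, a maximal separated set of points of \<open>K j\<close> gives finitely many disjoint
  cylinders of size comparable to \<open>\<delta>\<close>, and \<open>K j\<close> is covered by as many sets of diameter \<open>O(\<delta>)\<close>. By
  strong connectedness each cylinder can be shrunk, by a bounded factor, to the cylinder of a cycle
  (\<open>cycle_packing\<close>). If for some \<open>t\<close> below the dimension of \<open>K j\<close> the number of cycles were less than
  about \<open>\<delta>\<close> to the power \<open>-t\<close> at all scales, these coverings would make the Hausdorff measure of \<open>K j\<close>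
  vanish in a dimension below its Hausdorff dimension. Hence at some scale the ratios of the cycles
  satisfy \<open>1 \<le> (\<Sum>p. ratio p powr t)\<close>, even after one of them is removed
  (\<open>disjoint_cycles_of_large_sum\<close>). Under strong separation this inequality bounds the dimension of the
  attractor from below (\<open>le_hausdorff_dim_strongly_separated\<close>), which is proved by counting in finite
  covers.

  \<^emph>\<open>Group.\<close> By strong connectedness the \<open>j\<close>-th transformation group is generated by the matrices of
  finitely many cycles \<open>c\<^sub>1, \<dots>, c\<^sub>n\<close> (\<open>finitely_many_generating_cycles\<close>). If \<open>a\<close> and \<open>b\<close> are two of
  the disjoint cycles found above, the cycle \<open>a\<close> is replaced by
  \<open>a b, a\<^sup>2 b c\<^sub>1, a\<^sup>3 b c\<^sub>2, \<dots>\<close>. The new cylinders are disjoint subsets of the cylinder of \<open>a\<close>, and the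
  group generated by \<open>b\<close> and the new cycles contains \<open>a\<close>, hence every \<open>c\<^sub>i\<close>
  (\<open>disjoint_cycles_with_generators\<close>). The two transformation groups are therefore even equal.
\<close>

section \<open>Upper and lower bounds for Hausdorff dimension\<close>

lemma hausdorff_measure_mono:
  fixes A B :: "'a::metric_space set"
  assumes "A \<subseteq> B"
  shows "hausdorff_measure s A \<le> hausdorff_measure s B"
proof -
  have "delta_covers \<delta> B \<subseteq> delta_covers \<delta> A" for \<delta>
    using assms unfolding delta_covers_def by blast
  then show ?thesis
    unfolding hausdorff_measure_def hausdorff_premeasure_def
    by (intro SUP_mono') (rule INF_superset_mono, auto)
qed

lemma hausdorff_dim_le:
  fixes A :: "'a::euclidean_space set"
  assumes "0 \<le> s" "hausdorff_measure s A = 0"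
  shows "hausdorff_dim A \<le> s"
  unfolding hausdorff_dim_def
  by (rule cInf_lower) (use assms in \<open>auto intro: bdd_belowI[of _ 0]\<close>)

lemma le_hausdorff_dim:
  fixes A :: "'a::euclidean_space set"
  assumes "0 \<le> s" "hausdorff_measure s A = 0"
    and "\<And>s. 0 \<le> s \<Longrightarrow> s < t \<Longrightarrow> hausdorff_measure s A \<noteq> 0"
  shows "t \<le> hausdorff_dim A"
  unfolding hausdorff_dim_def
  by (rule cInf_greatest) (use assms in \<open>auto simp: not_less[symmetric]\<close>)

text \<open>
  The cover at level \<open>k\<close> contributes at most a constant times \<open>(\<alpha> * \<beta> powr s) ^ k\<close> to the Hausdorff
  sum, which tends to \<open>0\<close>.
\<close>

lemma hausdorff_measure_eq_0_if_geometric_covers: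
  fixes A :: "'a::metric_space set"
  assumes s: "0 < s" and b: "0 \<le> b" and \<beta>: "0 < \<beta>" "\<beta> < 1" and "0 \<le> \<alpha>" and "\<alpha> * \<beta> powr s < 1"
    and covers: "\<And>k::nat. \<exists>F. finite F \<and> real (card F) \<le> a * \<alpha> ^ k \<and> A \<subseteq> \<Union>F \<and>
                   (\<forall>U\<in>F. bounded U \<and> diameter U \<le> b * \<beta> ^ k)"
  shows "hausdorff_measure s A = 0"
proof -
  define x where "x k = a * b powr s * (\<alpha> * \<beta> powr s) ^ k" for k :: nat
  have x: "x k = (a * \<alpha> ^ k) * (b * \<beta> ^ k) powr s" for k
  proof -
    have "(\<beta> ^ k) powr s = (\<beta> powr s) ^ k"
      using \<beta> by (simp add: powr_realpow[symmetric] powr_powr mult.commute)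
    then show ?thesis
      using b \<beta> by (simp add: x_def powr_mult power_mult_distrib)
  qed
  have "x \<longlonglongrightarrow> a * b powr s * 0"
    unfolding x_def using assms by (intro tendsto_intros LIMSEQ_power_zero) auto
  then have lim: "(\<lambda>k. ennreal (x k)) \<longlonglongrightarrow> 0"
    by (auto dest: tendsto_ennrealI)
  have "hausdorff_premeasure s \<delta> A = 0" if "\<delta> > 0" for \<delta>
  proof -
    have "(\<lambda>k. b * \<beta> ^ k) \<longlonglongrightarrow> b * 0"
      using \<beta> by (intro tendsto_intros LIMSEQ_power_zero) auto
    then have "eventually (\<lambda>k. b * \<beta> ^ k < \<delta>) sequentially"
      using that by (auto intro: order_tendstoD)
    then have "eventually (\<lambda>k. hausdorff_premeasure s \<delta> A \<le> ennreal (x k)) sequentially"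
    proof eventually_elim
      case (elim k)
      obtain F where F: "finite F" "real (card F) \<le> a * \<alpha> ^ k" "A \<subseteq> \<Union>F"
        "\<And>U. U \<in> F \<Longrightarrow> bounded U \<and> diameter U \<le> b * \<beta> ^ k"
        using covers[of k] by blast
      obtain h where h: "bij_betw h {0..<card F} F"
        using ex_bij_betw_nat_finite[OF F(1)] by blast
      define U where "U i = (if i < card F then h i else {})" for i
      have hF: "h i \<in> F" if "i < card F" for i
        using h that by (auto simp: bij_betw_def)
      have "\<Union>F = (\<Union>i. U i)"
      proof
        show "\<Union>F \<subseteq> (\<Union>i. U i)"
          using bij_betw_imp_surj_on[OF h, symmetric] by (force simp: U_def)
        show "(\<Union>i. U i) \<subseteq> \<Union>F" using hF by (auto simp: U_def)
      qed
      moreover have "bounded (U i) \<and> diameter (U i) \<le> \<delta>" for i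
        using F(4)[OF hF] elim that by (force simp: U_def)
      ultimately have "U \<in> delta_covers \<delta> A"
        using F(3) by (auto simp: delta_covers_def)
      then have "hausdorff_premeasure s \<delta> A \<le> (\<Sum>i. diam_pow s (U i))"
        unfolding hausdorff_premeasure_def by (rule INF_lower)
      also have "\<dots> = (\<Sum>i<card F. diam_pow s (U i))"
        by (rule suminf_finite) (auto simp: U_def diam_pow_def)
      also have "\<dots> \<le> (\<Sum>i<card F. ennreal ((b * \<beta> ^ k) powr s))"
      proof (rule sum_mono)
        fix i assume "i \<in> {..<card F}"
        then have "bounded (U i)" "diameter (U i) \<le> b * \<beta> ^ k"
          using F(4)[OF hF] by (auto simp: U_def)
        then show "diam_pow s (U i) \<le> ennreal ((b * \<beta> ^ k) powr s)"
          using s by (auto simp: diam_pow_def diameter_ge_0 intro!: ennreal_leI powr_mono2)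
      qed
      also have "\<dots> = ennreal (real (card F) * (b * \<beta> ^ k) powr s)"
        by (simp add: ennreal_mult ennreal_of_nat_eq_real_of_nat)
      also have "\<dots> \<le> ennreal (x k)"
        unfolding x by (intro ennreal_leI mult_right_mono F) auto
      finally show ?case .
    qed
    with lim have "hausdorff_premeasure s \<delta> A \<le> 0"
      by (rule tendsto_lowerbound) auto
    then show ?thesis by simp
  qed
  then show ?thesis
    unfolding hausdorff_measure_def by (auto simp: SUP_eq_const intro!: SUP_eqI)
qed

text \<open>
  A substitute for the mass distribution principle, by induction on the number of sets. If some set of the
  cover has diameter at least \<open>\<gamma>\<close>, there is nothing to do. Otherwise every set meets at most one of the
  pieces \<open>S k ` K\<close>, so the cover contains disjoint subfamilies that cover the pieces. Each of them has
  fewer sets than the whole cover and is pulled back by \<open>S k\<close> to a cover of \<open>K\<close>, to which the induction hypothesis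
  applies; the assumption on \<open>\<Sum>k\<in>J. r k powr s\<close> reassembles the estimates.
\<close>

lemma separated_self_similar_cover_sum:
  fixes S :: "'i \<Rightarrow> 'a::euclidean_space \<Rightarrow> 'a" and K :: "'a set"
  assumes J: "finite J" "2 \<le> card J" and "K \<noteq> {}" and s: "0 < s"
    and r: "\<And>k. k \<in> J \<Longrightarrow> 0 < r k"
    and sim: "\<And>k x y. k \<in> J \<Longrightarrow> dist (S k x) (S k y) = r k * dist x y"
    and into: "\<And>k. k \<in> J \<Longrightarrow> S k ` K \<subseteq> K"
    and gap: "\<And>k l x y. k \<in> J \<Longrightarrow> l \<in> J \<Longrightarrow> k \<noteq> l \<Longrightarrow> x \<in> K \<Longrightarrow> y \<in> K \<Longrightarrow> \<gamma> \<le> dist (S k x) (S l y)"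
    and "0 < \<gamma>" and sum: "1 \<le> (\<Sum>k\<in>J. r k powr s)"
    and "finite I" "\<And>i. i \<in> I \<Longrightarrow> bounded (U i)" "K \<subseteq> (\<Union>i\<in>I. U i)"
  shows "\<gamma> powr s \<le> (\<Sum>i\<in>I. diameter (U i) powr s)"
  using assms(11-13)
proof (induction "card I" arbitrary: I U rule: less_induct)
  case less
  note bdd = less.prems(2)
  show ?case
  proof (cases "\<exists>i\<in>I. \<gamma> \<le> diameter (U i)")
    case True
    then obtain i where i: "i \<in> I" "\<gamma> \<le> diameter (U i)" by blast
    then have "\<gamma> powr s \<le> diameter (U i) powr s"
      using \<open>0 < \<gamma>\<close> s by (intro powr_mono2) auto
    also have "\<dots> \<le> (\<Sum>i\<in>I. diameter (U i) powr s)"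
      using i less.prems(1) by (intro member_le_sum) auto
    finally show ?thesis .
  next
    case False
    define part where "part k = {i \<in> I. U i \<inter> S k ` K \<noteq> {}}" for k
    have part_sub: "part k \<subseteq> I" for k by (auto simp: part_def)
    have fin: "finite (part k)" for k
      using less.prems(1) part_sub finite_subset by blast
    have part_ne: "part k \<noteq> {}" if "k \<in> J" for k
    proof -
      obtain x where "x \<in> K" using \<open>K \<noteq> {}\<close> by blast
      then have "S k x \<in> (\<Union>i\<in>I. U i)" using into[OF that] less.prems(3) by blast
      then show ?thesis using \<open>x \<in> K\<close> by (auto simp: part_def)
    qed
    have disj: "part k \<inter> part l = {}" if kl: "k \<in> J" "l \<in> J" "k \<noteq> l" for k l
    proof (rule ccontr)
      assume "part k \<inter> part l \<noteq> {}"
      then obtain i x y where i: "i \<in> I" "x \<in> K" "y \<in> K" "S k x \<in> U i" "S l y \<in> U i"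
        by (auto simp: part_def)
      then have "\<gamma> \<le> diameter (U i)"
        using gap[OF kl, of x y] diameter_bounded_bound[OF bdd[OF i(1)], of "S k x" "S l y"] by simp
      then show False using False i by blast
    qed
    have step: "r k powr s * \<gamma> powr s \<le> (\<Sum>i\<in>part k. diameter (U i) powr s)" if k: "k \<in> J" for k
    proof -
      define V where "V i = S k -` U i" for i
      have dV: "dist x y \<le> diameter (U i) / r k" if "i \<in> I" "x \<in> V i" "y \<in> V i" for i x y
        using diameter_bounded_bound[OF bdd[OF that(1)], of "S k x" "S k y"] that r[OF k] sim[OF k, of x y]
        by (simp add: V_def field_simps)
      have bV: "bounded (V i)" if "i \<in> I" for i
        using dV[OF that] unfolding bounded_def by (cases "V i = {}") blast+
      have diamV: "diameter (V i) \<le> diameter (U i) / r k" if "i \<in> I" for i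
        using dV[OF that] diameter_ge_0[OF bdd[OF that]] r[OF k]
        by (intro diameter_le) (auto simp: dist_norm)
      \<comment> \<open>Another piece has its own part of the cover, so the part of \<open>S k ` K\<close> is a proper one.\<close>
      have "\<exists>l\<in>J. l \<noteq> k"
        by (metis J card_le_Suc0_iff_eq not_less_eq_eq numeral_2_eq_2 k)
      then obtain l where "l \<in> J" "l \<noteq> k" by blast
      then have "part k \<subset> I"
        using part_ne[of l] disj[of k l] k part_sub by blast
      then have "card (part k) < card I"
        using less.prems(1) by (simp add: psubset_card_mono)
      moreover have "K \<subseteq> (\<Union>i\<in>part k. V i)"
      proof
        fix x assume x: "x \<in> K"
        then have "S k x \<in> (\<Union>i\<in>I. U i)" using into[OF k] less.prems(3) by blast
        then show "x \<in> (\<Union>i\<in>part k. V i)" using x by (auto simp: part_def V_def)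
      qed
      ultimately have "\<gamma> powr s \<le> (\<Sum>i\<in>part k. diameter (V i) powr s)"
        using less.hyps[of "part k" V] fin bV part_sub by blast
      also have "\<dots> \<le> (\<Sum>i\<in>part k. diameter (U i) powr s / r k powr s)"
      proof (rule sum_mono)
        fix i assume "i \<in> part k"
        then have i: "i \<in> I" using part_sub by blast
        have "diameter (V i) powr s \<le> (diameter (U i) / r k) powr s"
          using diamV[OF i] diameter_ge_0[OF bV[OF i]] s by (intro powr_mono2) auto
        then show "diameter (V i) powr s \<le> diameter (U i) powr s / r k powr s"
          using diameter_ge_0[OF bdd[OF i]] r[OF k] by (simp add: powr_divide)
      qed
      finally show ?thesis
        using r[OF k] by (simp add: sum_divide_distrib[symmetric] field_simps)
    qed
    have "1 * \<gamma> powr s \<le> (\<Sum>k\<in>J. r k powr s) * \<gamma> powr s"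
      by (intro mult_right_mono sum) auto
    also have "\<dots> = (\<Sum>k\<in>J. r k powr s * \<gamma> powr s)"
      by (simp add: sum_distrib_right)
    also have "\<dots> \<le> (\<Sum>k\<in>J. \<Sum>i\<in>part k. diameter (U i) powr s)"
      by (intro sum_mono step)
    also have "\<dots> = (\<Sum>i\<in>(\<Union>k\<in>J. part k). diameter (U i) powr s)"
      using J(1) fin disj by (intro sum.UNION_disjoint[symmetric]) auto
    also have "\<dots> \<le> (\<Sum>i\<in>I. diameter (U i) powr s)"
      using less.prems(1) part_sub by (intro sum_mono2) auto
    finally show ?thesis by simp
  qed
qed

lemma hausdorff_measure_0_neq_0:
  assumes "A \<noteq> {}"
  shows "hausdorff_measure 0 A \<noteq> 0"
proof -
  have "1 \<le> hausdorff_premeasure 0 1 A"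
    unfolding hausdorff_premeasure_def
  proof (rule INF_greatest)
    fix U assume "U \<in> delta_covers 1 A"
    then obtain i where "U i \<noteq> {}" using assms by (fastforce simp: delta_covers_def)
    then have "1 = (\<Sum>i\<in>{i}. diam_pow 0 (U i))" by (simp add: diam_pow_def)
    also have "\<dots> \<le> (\<Sum>i. diam_pow 0 (U i))" by (rule sum_le_suminf) auto
    finally show "1 \<le> (\<Sum>i. diam_pow 0 (U i))" .
  qed
  also have "\<dots> \<le> hausdorff_measure 0 A"
    unfolding hausdorff_measure_def by (rule SUP_upper) simp
  finally show ?thesis by auto
qed

text \<open>
  Countable covers reduce to finite ones: every set is enlarged to an open set of at most twice its
  diameter (or of tiny diameter if it is almost a point), and compactness selects finitely many.
\<close>

lemma compact_hausdorff_measure_neq_0: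
  fixes K :: "'a::euclidean_space set"
  assumes "compact K" and s: "0 < s" and c: "0 < c"
    and lower: "\<And>I (U :: nat \<Rightarrow> 'a set). finite I \<Longrightarrow> (\<And>i. i \<in> I \<Longrightarrow> bounded (U i)) \<Longrightarrow>
        K \<subseteq> (\<Union>i\<in>I. U i) \<Longrightarrow> c \<le> (\<Sum>i\<in>I. diameter (U i) powr s)"
  shows "hausdorff_measure s K \<noteq> 0"
proof
  assume "hausdorff_measure s K = 0"
  then have "hausdorff_premeasure s 1 K = 0"
    unfolding hausdorff_measure_def
    by (metis SUP_upper greaterThan_iff le_zero_eq zero_less_one)
  define \<eta> where "\<eta> = c / 2 powr s / 4"
  have \<eta>: "\<eta> > 0" using c by (simp add: \<eta>_def)
  have "(INF U\<in>delta_covers 1 K. \<Sum>i. diam_pow s (U i)) < ennreal \<eta>"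
    using \<open>hausdorff_premeasure s 1 K = 0\<close> \<eta> by (simp add: hausdorff_premeasure_def)
  then obtain U where U: "U \<in> delta_covers 1 K" "(\<Sum>i. diam_pow s (U i)) < ennreal \<eta>"
    by (auto simp: INF_less_iff)
  have bU: "bounded (U i)" and KU: "K \<subseteq> (\<Union>i. U i)" for i
    using U(1) by (auto simp: delta_covers_def)
  \<comment> \<open>The lower bound keeps \<open>w i\<close> positive when \<open>U i\<close> is a single point; the \<open>s\<close>-th powers of these
    lower bounds sum to \<open>\<eta>\<close>.\<close>
  define w where "w i = max (diameter (U i)) ((\<eta> * (1/2) ^ Suc i) powr (1 / s))" for i
  have wpos: "w i > 0" for i using \<eta> by (auto simp: w_def less_max_iff_disj)
  define W where "W i = (\<Union>x\<in>U i. ball x (w i / 2))" for i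
  have dW: "dist x y \<le> 2 * w i" if xy: "x \<in> W i" "y \<in> W i" for i x y
  proof -
    obtain x' y' where "x' \<in> U i" "y' \<in> U i" "dist x' x < w i / 2" "dist y' y < w i / 2"
      using xy by (auto simp: W_def)
    moreover have "dist x' y' \<le> w i"
      using diameter_bounded_bound[OF bU \<open>x' \<in> U i\<close> \<open>y' \<in> U i\<close>] by (simp add: w_def)
    ultimately show ?thesis
      using dist_triangle[of x y x'] dist_triangle[of x' y y'] by (simp add: dist_commute)
  qed
  have bW: "bounded (W i)" for i
    using dW unfolding bounded_def by (cases "W i = {}") blast+
  have diamW: "diameter (W i) \<le> 2 * w i" for i
    using dW wpos[of i] by (intro diameter_le) (auto simp: dist_norm less_imp_le)
  have powW: "diameter (W i) powr s \<le> 2 powr s * (enn2real (diam_pow s (U i)) + \<eta> * (1/2) ^ Suc i)" for i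
  proof (cases "U i = {}")
    case True
    then show ?thesis using \<eta> by (simp add: W_def)
  next
    case False
    have "diameter (W i) powr s \<le> (2 * w i) powr s"
      using diamW diameter_ge_0[OF bW] s by (intro powr_mono2) auto
    also have "\<dots> = 2 powr s * w i powr s"
      using wpos[of i] by (simp add: powr_mult)
    also have "w i powr s \<le> diameter (U i) powr s + \<eta> * (1/2) ^ Suc i"
      using s \<eta> by (auto simp: w_def max_def powr_powr)
    finally show ?thesis
      using False s by (simp add: diam_pow_def)
  qed
  obtain I where I: "finite I" "K \<subseteq> (\<Union>i\<in>I. W i)"
  proof -
    have "K \<subseteq> (\<Union>i. W i)"
    proof
      fix x assume "x \<in> K"
      then obtain i where "x \<in> U i" using KU by blast
      then have "x \<in> W i" using wpos[of i] by (auto simp: W_def intro!: bexI[of _ x])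
      then show "x \<in> (\<Union>i. W i)" by blast
    qed
    moreover have "open (W i)" for i by (auto simp: W_def)
    ultimately show ?thesis
      using compactE_image[OF \<open>compact K\<close>, of UNIV W] that by auto
  qed
  have "c \<le> (\<Sum>i\<in>I. diameter (W i) powr s)"
    by (rule lower) (use I bW in auto)
  also have "\<dots> \<le> (\<Sum>i\<in>I. 2 powr s * (enn2real (diam_pow s (U i)) + \<eta> * (1/2) ^ Suc i))"
    by (intro sum_mono powW)
  also have "\<dots> = 2 powr s * ((\<Sum>i\<in>I. enn2real (diam_pow s (U i))) + \<eta> * (\<Sum>i\<in>I. (1/2) ^ Suc i))"
    by (simp only: sum_distrib_left[symmetric] sum.distrib)
  also have "\<dots> \<le> 2 powr s * (\<eta> + \<eta> * 1)"
  proof (intro mult_left_mono add_mono)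
    have "ennreal (\<Sum>i\<in>I. enn2real (diam_pow s (U i))) = (\<Sum>i\<in>I. diam_pow s (U i))"
      by (subst sum_ennreal[symmetric]) (auto simp: diam_pow_def intro!: sum.cong)
    also have "\<dots> \<le> (\<Sum>i. diam_pow s (U i))"
      by (rule sum_le_suminf) (auto simp: I)
    finally have "ennreal (\<Sum>i\<in>I. enn2real (diam_pow s (U i))) \<le> ennreal \<eta>"
      using U(2) by auto
    then show "(\<Sum>i\<in>I. enn2real (diam_pow s (U i))) \<le> \<eta>"
      using \<eta> by (simp add: ennreal_le_iff)
    show "(\<Sum>i\<in>I. (1/2::real) ^ Suc i) \<le> 1"
      using sum_le_suminf[OF sums_summable[OF power_half_series] I(1)]
      by (simp only: sums_unique[OF power_half_series, symmetric]) simp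
  qed (use \<eta> in auto)
  also have "\<dots> = c / 2" by (simp add: \<eta>_def field_simps)
  finally show False using c by simp
qed

section \<open>Self-similar subsets of forward invariant compact sets\<close>

text \<open>
  The attractor is the intersection of the decreasing images of \<open>C\<close> under the iterated union map.
\<close>

lemma self_similar_subset_exists:
  fixes S :: "'i \<Rightarrow> 'a::heine_borel \<Rightarrow> 'a"
  assumes J: "finite J" "J \<noteq> {}" and C: "compact C" "C \<noteq> {}"
    and cont: "\<And>i. i \<in> J \<Longrightarrow> continuous_on UNIV (S i)"
    and inj: "\<And>i. i \<in> J \<Longrightarrow> inj (S i)"
    and into: "\<And>i. i \<in> J \<Longrightarrow> S i ` C \<subseteq> C"
  obtains K where "K \<noteq> {}" "compact K" "K \<subseteq> C" "K = (\<Union>i\<in>J. S i ` K)"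
proof -
  define \<Phi> where "\<Phi> A = (\<Union>i\<in>J. S i ` A)" for A
  define F where "F n = (\<Phi> ^^ n) C" for n
  have F_0: "F 0 = C" and F_Suc: "F (Suc n) = \<Phi> (F n)" for n by (auto simp: F_def)
  have mono: "A \<subseteq> B \<Longrightarrow> \<Phi> A \<subseteq> \<Phi> B" for A B by (fastforce simp: \<Phi>_def)
  have F_step: "F (Suc n) \<subseteq> F n" for n
  proof (induction n)
    case 0
    show ?case using into by (auto simp: F_0 F_Suc \<Phi>_def)
  next
    case (Suc n)
    then show ?case using mono by (metis F_Suc)
  qed
  then have F_dec: "m \<le> n \<Longrightarrow> F n \<subseteq> F m" for m n
    by (rule lift_Suc_antimono_le)
  have "compact (F n) \<and> F n \<noteq> {}" for n
  proof (induction n)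
    case (Suc n)
    then show ?case
      using J by (auto simp: F_Suc \<Phi>_def intro!: compact_UN compact_continuous_image
          intro: continuous_on_subset[OF cont])
  qed (use C F_0 in auto)
  then have ne: "\<Inter>(range F) \<noteq> {}" and com: "compact (\<Inter>(range F))"
    using compact_nest[of F] F_dec by (auto intro: compact_Inter)
  have "\<Inter>(range F) = \<Phi> (\<Inter>(range F))"
  proof
    have "\<Phi> (\<Inter>(range F)) \<subseteq> F n" for n
      using mono[of "\<Inter>(range F)" "F n"] F_step[of n] by (auto simp: F_Suc)
    then show "\<Phi> (\<Inter>(range F)) \<subseteq> \<Inter>(range F)" by blast
    show "\<Inter>(range F) \<subseteq> \<Phi> (\<Inter>(range F))"
    proof
      fix y assume y: "y \<in> \<Inter>(range F)"
      then have "\<exists>i\<in>J. y \<in> S i ` F n" for n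
      proof -
        have "y \<in> F (Suc n)" using y by blast
        then show ?thesis by (auto simp: F_Suc \<Phi>_def)
      qed
      then obtain f where f: "\<And>n. f n \<in> J" "\<And>n. y \<in> S (f n) ` F n" by metis
      \<comment> \<open>One map serves infinitely many levels, hence all levels because they are nested.\<close>
      obtain i where i: "infinite {n. f n = i}" and "i \<in> J"
      proof -
        have "finite (range f)" using J(1) f(1) by (auto intro: finite_subset[of _ J])
        then obtain n where "infinite {m. f m = f n}"
          using pigeonhole_infinite[of UNIV f] by auto
        then show thesis using that f(1) by blast
      qed
      have "y \<in> S i ` F n" for n
      proof -
        obtain m where "n \<le> m" "f m = i"
          using i unfolding infinite_nat_iff_unbounded_le by blast
        then show ?thesis using f(2)[of m] F_dec by blast
      qed
      then obtain x where "y = S i x" "\<And>n. x \<in> F n"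
        using inj[OF \<open>i \<in> J\<close>] by (metis imageE injD)
      then show "y \<in> \<Phi> (\<Inter>(range F))" using \<open>i \<in> J\<close> by (auto simp: \<Phi>_def)
    qed
  qed
  then show thesis
    using that[of "\<Inter>(range F)"] ne com F_0 by (auto simp: \<Phi>_def)
qed

section \<open>Similarities and self-similar sets\<close>

lemma norm_orthogonal_matrix_mult:
  fixes A :: "real^'n^'n"
  assumes "orthogonal_matrix A"
  shows "norm (A *v x) = norm x"
proof -
  have "(A *v x) \<bullet> (A *v x) = (transpose A *v (A *v x)) \<bullet> x"
    by (simp add: dot_lmul_matrix transpose_matrix_vector)
  also have "\<dots> = x \<bullet> x"
    using assms by (simp add: matrix_vector_mul_assoc orthogonal_matrix)
  finally show ?thesis by (simp add: norm_eq_sqrt_inner)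
qed

lemma dist_similarity_map:
  assumes "contracting_similarity_data r T"
  shows "dist (similarity_map r T v x) (similarity_map r T v y) = r * dist x y"
proof -
  have "similarity_map r T v x - similarity_map r T v y = r *\<^sub>R (T *v (x - y))"
    by (simp add: similarity_map_def matrix_vector_mult_diff_distrib scaleR_diff_right)
  then show ?thesis
    using assms by (simp add: dist_norm contracting_similarity_data_def norm_orthogonal_matrix_mult)
qed

lemma similarity_map_comp:
  "similarity_map r T v (similarity_map r' T' v' x) =
     similarity_map (r * r') (T ** T') (similarity_map r T v v') x"
  by (simp add: similarity_map_def matrix_vector_right_distrib matrix_vector_mult_scaleR
      matrix_vector_mul_assoc scaleR_add_right)

lemma continuous_on_similarity_map: "continuous_on A (similarity_map r T v)"
  unfolding similarity_map_def
  by (intro continuous_intros linear_continuous_on linear_conv_bounded_linear[THEN iffD1]) simp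

lemma finite_disjoint_compact_gap:
  fixes C :: "'i \<Rightarrow> 'a::heine_borel set"
  assumes "finite J" "\<And>i. i \<in> J \<Longrightarrow> compact (C i)" "disjoint_family_on C J"
  obtains \<gamma> where "0 < \<gamma>"
    "\<And>i j x y. i \<in> J \<Longrightarrow> j \<in> J \<Longrightarrow> i \<noteq> j \<Longrightarrow> x \<in> C i \<Longrightarrow> y \<in> C j \<Longrightarrow> \<gamma> \<le> dist x y"
proof -
  define P where "P = {(i, j). i \<in> J \<and> j \<in> J \<and> i \<noteq> j}"
  have "finite P"
    by (rule finite_subset[of _ "J \<times> J"]) (use assms in \<open>auto simp: P_def\<close>)
  have "\<forall>p\<in>P. \<exists>d>0. \<forall>x\<in>C (fst p). \<forall>y\<in>C (snd p). d \<le> dist x y"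
  proof
    fix p assume "p \<in> P"
    then have "compact (C (fst p))" "closed (C (snd p))" "C (fst p) \<inter> C (snd p) = {}"
      using assms by (auto simp: P_def compact_imp_closed dest: disjoint_family_onD[of C J "fst p" "snd p"])
    then show "\<exists>d>0. \<forall>x\<in>C (fst p). \<forall>y\<in>C (snd p). d \<le> dist x y"
      by (rule separate_compact_closed)
  qed
  then obtain d where d: "\<And>p. p \<in> P \<Longrightarrow> d p > 0"
    "\<And>p x y. p \<in> P \<Longrightarrow> x \<in> C (fst p) \<Longrightarrow> y \<in> C (snd p) \<Longrightarrow> d p \<le> dist x y"
    by metis
  define \<gamma> where "\<gamma> = Min (insert 1 (d ` P))"
  have "0 < \<gamma>" using \<open>finite P\<close> d(1) by (simp add: \<gamma>_def)
  moreover have "\<gamma> \<le> d p" if "p \<in> P" for p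
    using that \<open>finite P\<close> by (simp add: \<gamma>_def)
  moreover have "d (i, j) \<le> dist x y" if "i \<in> J" "j \<in> J" "i \<noteq> j" "x \<in> C i" "y \<in> C j" for i j x y
    using d(2)[of "(i, j)" x y] that by (simp add: P_def)
  moreover have "(i, j) \<in> P" if "i \<in> J" "j \<in> J" "i \<noteq> j" for i j
    using that by (simp add: P_def)
  ultimately show thesis
    using that[of \<gamma>] by (meson order_trans)
qed

text \<open>
  The sum condition at \<open>t\<close> passes to every smaller exponent because the ratios are below \<open>1\<close>, so the
  Hausdorff measure is nonzero in every dimension below \<open>t\<close>. The exponent \<open>u\<close> ensures that the infimum
  defining the dimension ranges over a nonempty set.
\<close>

lemma le_hausdorff_dim_strongly_separated:
  assumes ifs: "ss_ifs m r T" and attr: "ss_attractor m r T v K" and ssc: "strong_separation m r T v K"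
    and "2 \<le> m" and sum: "1 \<le> (\<Sum>i=1..m. r i powr t)"
    and fin_dim: "0 \<le> u" "hausdorff_measure u K = 0"
  shows "t \<le> hausdorff_dim K"
proof (rule le_hausdorff_dim[OF fin_dim])
  fix s assume s: "0 \<le> s" "s < t"
  let ?S = "\<lambda>i. similarity_map (r i) (T i) (v i)"
  have K: "K \<noteq> {}" "compact K" and K_eq: "K = (\<Union>i\<in>{1..m}. ?S i ` K)"
    using attr by (auto simp: ss_attractor_def)
  have into: "?S i ` K \<subseteq> K" if "i \<in> {1..m}" for i
    using K_eq that by blast
  have data: "contracting_similarity_data (r i) (T i)" if "i \<in> {1..m}" for i
    using ifs that by (auto simp: ss_ifs_def)
  then have r: "0 < r i" "r i < 1" if "i \<in> {1..m}" for i
    using that by (auto simp: contracting_similarity_data_def)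
  show "hausdorff_measure s K \<noteq> 0"
  proof (cases "s = 0")
    case True
    then show ?thesis using hausdorff_measure_0_neq_0[OF K(1)] by simp
  next
    case False
    have "(\<Sum>i=1..m. r i powr t) \<le> (\<Sum>i=1..m. r i powr s)"
      using r s by (intro sum_mono powr_mono') (auto simp: less_imp_le)
    with sum have sum_s: "1 \<le> (\<Sum>i=1..m. r i powr s)" by simp
    obtain \<gamma> where \<gamma>: "0 < \<gamma>" "\<And>i j x y. i \<in> {1..m} \<Longrightarrow> j \<in> {1..m} \<Longrightarrow> i \<noteq> j \<Longrightarrow>
        x \<in> ?S i ` K \<Longrightarrow> y \<in> ?S j ` K \<Longrightarrow> \<gamma> \<le> dist x y"
      using finite_disjoint_compact_gap[of "{1..m}" "\<lambda>i. ?S i ` K"] ssc K(2)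
      by (auto simp: strong_separation_def compact_continuous_image continuous_on_similarity_map)
    show ?thesis
    proof (rule compact_hausdorff_measure_neq_0[OF K(2)])
      show "0 < s" "0 < \<gamma> powr s" using s False \<gamma>(1) by auto
      fix I and U :: "nat \<Rightarrow> (real^'a) set"
      assume "finite I" "\<And>i. i \<in> I \<Longrightarrow> bounded (U i)" "K \<subseteq> (\<Union>i\<in>I. U i)"
      then show "\<gamma> powr s \<le> (\<Sum>i\<in>I. diameter (U i) powr s)"
        using \<open>2 \<le> m\<close> K(1) r \<gamma> \<open>0 < s\<close> sum_s into
        by (intro separated_self_similar_cover_sum[of "{1..m}" K s r ?S \<gamma> I U])
           (simp_all add: dist_similarity_map data)
    qed
  qed
qed

section \<open>Separated nets\<close>

lemma finite_separated_subset:
  fixes F :: "'a::metric_space set"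
  assumes "finite F" "0 \<le> \<eta>"
  shows "\<exists>E\<subseteq>F. (\<forall>x\<in>E. \<forall>y\<in>E. x \<noteq> y \<longrightarrow> \<eta> < dist x y) \<and> (\<forall>y\<in>F. \<exists>x\<in>E. dist x y \<le> \<eta>)"
  using assms(1)
proof (induction F)
  case (insert z F)
  then obtain E where E: "E \<subseteq> F" "\<forall>x\<in>E. \<forall>y\<in>E. x \<noteq> y \<longrightarrow> \<eta> < dist x y"
    "\<forall>y\<in>F. \<exists>x\<in>E. dist x y \<le> \<eta>" by blast
  show ?case
  proof (cases "\<exists>x\<in>E. dist x z \<le> \<eta>")
    case True
    then have "\<forall>y\<in>insert z F. \<exists>x\<in>E. dist x y \<le> \<eta>" using E(3) by simp
    then show ?thesis using E(1,2) by (intro exI[of _ E] conjI) auto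
  next
    case False
    then have far: "\<eta> < dist x z" "\<eta> < dist z x" if "x \<in> E" for x
      using that by (auto simp: not_le dist_commute)
    show ?thesis
    proof (intro exI[of _ "insert z E"] conjI)
      show "\<forall>x\<in>insert z E. \<forall>y\<in>insert z E. x \<noteq> y \<longrightarrow> \<eta> < dist x y"
        using E(2) far by simp
      show "\<forall>y\<in>insert z F. \<exists>x\<in>insert z E. dist x y \<le> \<eta>"
        using E(3) \<open>0 \<le> \<eta>\<close> by simp
    qed (use E(1) in auto)
  qed
qed simp

lemma compact_separated_net:
  fixes A :: "'a::metric_space set"
  assumes "compact A" "0 < \<eta>"
  obtains E where "finite E" "E \<subseteq> A" "\<forall>x\<in>E. \<forall>y\<in>E. x \<noteq> y \<longrightarrow> \<eta> < dist x y"
    "A \<subseteq> (\<Union>x\<in>E. cball x (2 * \<eta>))"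
proof -
  have "A \<subseteq> (\<Union>x\<in>A. ball x \<eta>)" using \<open>0 < \<eta>\<close> by auto
  then obtain F where F: "F \<subseteq> A" "finite F" "A \<subseteq> (\<Union>x\<in>F. ball x \<eta>)"
    by (rule compactE_image[OF \<open>compact A\<close> open_ball])
  obtain E where E: "E \<subseteq> F" "\<And>x y. x \<in> E \<Longrightarrow> y \<in> E \<Longrightarrow> x \<noteq> y \<Longrightarrow> \<eta> < dist x y"
    "\<And>y. y \<in> F \<Longrightarrow> \<exists>x\<in>E. dist x y \<le> \<eta>"
    using finite_separated_subset[OF F(2) less_imp_le[OF \<open>0 < \<eta>\<close>]] by metis
  have "A \<subseteq> (\<Union>x\<in>E. cball x (2 * \<eta>))"
  proof
    fix z assume "z \<in> A"
    then obtain y where y: "y \<in> F" "dist y z < \<eta>" using F(3) by auto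
    then obtain x where "x \<in> E" "dist x y \<le> \<eta>" using E(3) by blast
    then show "z \<in> (\<Union>x\<in>E. cball x (2 * \<eta>))"
      using y(2) dist_triangle[of x z y] by (intro UN_I[of x]) auto
  qed
  moreover have "finite E" "E \<subseteq> A" using E(1) F(1,2) finite_subset by auto
  ultimately show thesis using that E(2) by simp
qed

section \<open>A cancellation rule for subgroups\<close>

text \<open>
  The element in question is \<open>(x \<otimes> y) \<otimes> inv (z \<otimes> y) \<otimes> (z \<otimes> w)\<close>. With \<open>\<one>\<close> for suitable arguments, this
  is also the cancellation of a left or a right factor.
\<close>

lemma (in group) subgroup_splice:
  assumes "subgroup H G" and c: "x \<in> carrier G" "y \<in> carrier G" "z \<in> carrier G" "w \<in> carrier G"
    and "x \<otimes> y \<in> H" "z \<otimes> y \<in> H" "z \<otimes> w \<in> H"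
  shows "x \<otimes> w \<in> H"
proof -
  interpret H: subgroup H G by fact
  have "inv z \<otimes> (z \<otimes> w) = w" "y \<otimes> (inv y \<otimes> w) = w"
    using c by (simp_all add: m_assoc[symmetric])
  then have "(x \<otimes> y) \<otimes> inv (z \<otimes> y) \<otimes> (z \<otimes> w) = x \<otimes> w"
    using c by (simp add: inv_mult_group m_assoc)
  moreover have "(x \<otimes> y) \<otimes> inv (z \<otimes> y) \<otimes> (z \<otimes> w) \<in> H"
    by (rule H.m_closed[OF H.m_closed[OF assms(6) H.m_inv_closed[OF assms(7)]] assms(8)])
  ultimately show ?thesis by simp
qed

section \<open>The maps along walks\<close>

definition path_ratio :: "('e \<Rightarrow> real) \<Rightarrow> 'e list \<Rightarrow> real" where
  "path_ratio r p = prod_list (map r p)"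

definition path_map ::
  "('e \<Rightarrow> real) \<Rightarrow> ('e \<Rightarrow> real^'n^'n) \<Rightarrow> ('e \<Rightarrow> real^'n) \<Rightarrow> 'e list \<Rightarrow> real^'n \<Rightarrow> real^'n" where
  "path_map r T v = foldr (\<lambda>e. similarity_map (r e) (T e) (v e))"

lemma path_ratio_simps [simp]:
  "path_ratio r [] = 1" "path_ratio r (e # p) = r e * path_ratio r p"
  "path_ratio r (p @ p') = path_ratio r p * path_ratio r p'"
  by (simp_all add: path_ratio_def)

lemma path_map_simps [simp]:
  "path_map r T v [] x = x"
  "path_map r T v (e # p) x = similarity_map (r e) (T e) (v e) (path_map r T v p x)"
  "path_map r T v (p @ p') x = path_map r T v p (path_map r T v p' x)"
  by (simp_all add: path_map_def)

lemma path_matrix_simps [simp]: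
  "path_matrix T [] = mat 1" "path_matrix T (e # p) = T e ** path_matrix T p"
  "path_matrix T (p @ p') = path_matrix T p ** path_matrix T p'"
proof -
  show "path_matrix T (p @ p') = path_matrix T p ** path_matrix T p'"
    by (induction p) (simp_all add: path_matrix_def matrix_mul_assoc)
qed (simp_all add: path_matrix_def)

lemma path_map_eq_similarity_map:
  "path_map r T v p x = similarity_map (path_ratio r p) (path_matrix T p) (path_map r T v p 0) x"
proof (induction p)
  case Nil
  then show ?case by (simp add: similarity_map_def)
next
  case (Cons e p)
  show ?case
    by (subst path_map_simps(2), subst Cons.IH) (simp add: similarity_map_comp)
qed

locale gd_system = fin_digraph G for G :: "(nat, 'e) pre_digraph" +
  fixes r :: "'e \<Rightarrow> real" and T :: "'e \<Rightarrow> real^'n^'n" and v :: "'e \<Rightarrow> real^'n"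
    and K :: "nat \<Rightarrow> (real^'n) set"
  assumes data: "e \<in> arcs G \<Longrightarrow> contracting_similarity_data (r e) (T e)"
    and attractor: "gd_attractor G r T v K"
    and connected: "strongly_connected G"
begin

abbreviation "ratio \<equiv> path_ratio r"
abbreviation "S \<equiv> path_map r T v"

lemma arc_ratio: "e \<in> arcs G \<Longrightarrow> 0 < r e \<and> r e < 1"
  using data by (auto simp: contracting_similarity_data_def)

lemma ratio_pos: "set p \<subseteq> arcs G \<Longrightarrow> 0 < ratio p"
  by (induction p) (auto simp: arc_ratio)

lemma ratio_le_1: "set p \<subseteq> arcs G \<Longrightarrow> ratio p \<le> 1"
  by (induction p) (use arc_ratio ratio_pos in \<open>auto intro!: mult_le_one simp: less_imp_le\<close>)

lemma orthogonal_path_matrix: "set p \<subseteq> arcs G \<Longrightarrow> orthogonal_matrix (path_matrix T p)"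
  using data
  by (induction p)
     (auto simp: orthogonal_matrix_id contracting_similarity_data_def intro!: orthogonal_matrix_mul)

lemma path_data:
  assumes "set p \<subseteq> arcs G" "p \<noteq> []"
  shows "contracting_similarity_data (ratio p) (path_matrix T p)"
proof -
  have "ratio p < 1"
  proof (cases p)
    case (Cons e p')
    then have "r e * ratio p' \<le> r e * 1"
      using assms ratio_le_1[of p'] arc_ratio[of e] by (intro mult_left_mono) auto
    also have "\<dots> < 1" using Cons assms arc_ratio[of e] by auto
    finally show ?thesis using Cons by simp
  qed (use assms in auto)
  then show ?thesis
    using assms ratio_pos orthogonal_path_matrix by (simp add: contracting_similarity_data_def)
qed

lemma dist_S: "set p \<subseteq> arcs G \<Longrightarrow> dist (S p x) (S p y) = ratio p * dist x y"
  by (induction p) (auto simp: dist_similarity_map data)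

lemma inj_S: "set p \<subseteq> arcs G \<Longrightarrow> inj (S p)"
proof (rule injI)
  fix x y assume p: "set p \<subseteq> arcs G" and "S p x = S p y"
  then have "ratio p * dist x y = 0" using dist_S[OF p, of x y] by simp
  then show "x = y" using ratio_pos[OF p] by simp
qed

lemma attractor_at:
  assumes "i \<in> verts G"
  shows K_ne: "K i \<noteq> {}" and compact_K: "compact (K i)"
    and K_eq: "K i = (\<Union>k\<in>verts G. \<Union>e\<in>arcs_between G i k. similarity_map (r e) (T e) (v e) ` K k)"
proof -
  note h = bspec[OF attractor[unfolded gd_attractor_def] assms]
  show "K i \<noteq> {}" by (rule conjunct1[OF h])
  show "compact (K i)" by (rule conjunct1[OF conjunct2[OF h]])
  show "K i = (\<Union>k\<in>verts G. \<Union>e\<in>arcs_between G i k. similarity_map (r e) (T e) (v e) ` K k)"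
    by (rule conjunct2[OF conjunct2[OF h]])
qed

lemma K_unfold:
  assumes "i \<in> verts G"
  shows "K i = (\<Union>e\<in>{e \<in> arcs G. tail G e = i}. similarity_map (r e) (T e) (v e) ` K (head G e))"
proof -
  have "K i = (\<Union>k\<in>verts G. \<Union>e\<in>arcs_between G i k. similarity_map (r e) (T e) (v e) ` K k)"
    by (rule K_eq[OF assms])
  also have "\<dots> = (\<Union>e\<in>{e \<in> arcs G. tail G e = i}. similarity_map (r e) (T e) (v e) ` K (head G e))"
    unfolding arcs_between_def using head_in_verts by blast
  finally show ?thesis .
qed

lemma K_cases:
  assumes "i \<in> verts G" "x \<in> K i"
  obtains e y where "e \<in> arcs G" "tail G e = i" "y \<in> K (head G e)"
    "x = similarity_map (r e) (T e) (v e) y"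
  using assms(2) unfolding K_unfold[OF assms(1)] by blast

lemma S_image_subset: "awalk i p k \<Longrightarrow> S p ` K k \<subseteq> K i"
proof (induction p arbitrary: i)
  case (Cons e p)
  then have e: "e \<in> arcs G" "tail G e = i" "awalk (head G e) p k" "i \<in> verts G"
    by (auto simp: awalk_Cons_iff)
  then have "S p ` K k \<subseteq> K (head G e)" by (intro Cons.IH)
  then show ?case using e K_unfold[OF e(4)] by auto
qed (auto simp: awalk_Nil_iff)

lemma common_diameter_bound:
  obtains M where "0 < M" "\<And>i x y. i \<in> verts G \<Longrightarrow> x \<in> K i \<Longrightarrow> y \<in> K i \<Longrightarrow> dist x y \<le> M"
proof -
  let ?A = "\<Union>i\<in>verts G. K i"
  have A: "bounded ?A"
    using compact_K by (auto simp: compact_imp_bounded)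
  have "dist x y \<le> diameter ?A + 1" if "i \<in> verts G" "x \<in> K i" "y \<in> K i" for i x y
    using diameter_bounded_bound[OF A, of x y] that by fastforce
  moreover have "0 < diameter ?A + 1" using diameter_ge_0[OF A] by simp
  ultimately show thesis by (rule that[rotated])
qed

lemma arc_ratio_bounds:
  obtains \<rho>0 \<rho>1 where "0 < \<rho>0" "0 < \<rho>1" "\<rho>1 < 1" "\<And>e. e \<in> arcs G \<Longrightarrow> \<rho>0 \<le> r e \<and> r e \<le> \<rho>1"
proof -
  define R where "R = insert (1/2) (r ` arcs G)"
  have R: "finite R" "R \<noteq> {}" "\<And>x. x \<in> R \<Longrightarrow> 0 < x \<and> x < 1"
    using arc_ratio by (auto simp: R_def)
  have "0 < Min R" "0 < Max R" "Max R < 1"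
    using R(3)[OF Min_in[OF R(1,2)]] R(3)[OF Max_in[OF R(1,2)]] by auto
  moreover have "Min R \<le> r e \<and> r e \<le> Max R" if "e \<in> arcs G" for e
    using that R(1) by (auto simp: R_def intro: Min_le Max_ge)
  ultimately show thesis by (rule that)
qed

text \<open>
  Follow the address of \<open>x\<close> and stop at the first arc that brings the ratio down to \<open>\<delta>\<close>; this last arc
  multiplies the ratio by at least \<open>\<rho>0\<close>. The condition on \<open>n\<close> makes this happen within \<open>n + 1\<close> arcs.
\<close>

lemma walk_of_comparable_ratio:
  assumes \<rho>: "0 < \<rho>0" "\<And>e. e \<in> arcs G \<Longrightarrow> \<rho>0 \<le> r e \<and> r e \<le> \<rho>1" "0 < \<rho>1"
    and "i \<in> verts G" "x \<in> K i" "0 < \<delta>" "\<delta> \<le> 1" "\<rho>1 ^ n \<le> \<delta>"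
  shows "\<exists>p k. awalk i p k \<and> p \<noteq> [] \<and> x \<in> S p ` K k \<and> \<rho>0 * \<delta> \<le> ratio p \<and> ratio p \<le> \<delta>"
  using assms(4-)
proof (induction n arbitrary: i x \<delta>)
  case (0 i x \<delta>)
  obtain e y where e: "e \<in> arcs G" "tail G e = i" "y \<in> K (head G e)"
    "x = similarity_map (r e) (T e) (v e) y"
    using K_cases[OF 0(1,2)] .
  have "\<rho>0 * \<delta> \<le> r e" "r e \<le> \<delta>"
    using 0 \<rho>(1) \<rho>(2)[OF e(1)] arc_ratio[OF e(1)] by auto
  moreover have "awalk i [e] (head G e)" "x \<in> S [e] ` K (head G e)"
    using e 0(1) by (auto simp: awalk_Cons_iff awalk_Nil_iff)
  ultimately show ?case
    by (intro exI[of _ "[e]"] exI[of _ "head G e"]) simp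
next
  case (Suc n i x \<delta>)
  obtain e y where e: "e \<in> arcs G" "tail G e = i" "y \<in> K (head G e)"
    "x = similarity_map (r e) (T e) (v e) y"
    using K_cases[OF Suc.prems(1,2)] .
  have re: "0 < r e" "r e \<le> \<rho>1" "\<rho>0 \<le> r e" using \<rho>(2)[OF e(1)] arc_ratio[OF e(1)] by auto
  show ?case
  proof (cases "r e \<le> \<delta>")
    case True
    have "\<rho>0 * \<delta> \<le> \<rho>0 * 1" using Suc.prems(4) \<rho>(1) by (intro mult_left_mono) auto
    then have "\<rho>0 * \<delta> \<le> r e" using re by linarith
    moreover have "awalk i [e] (head G e)" "x \<in> S [e] ` K (head G e)"
      using e by (auto simp: awalk_Cons_iff awalk_Nil_iff)
    ultimately show ?thesis
      using True by (intro exI[of _ "[e]"] exI[of _ "head G e"]) simp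
  next
    case False
    have "\<rho>1 ^ n \<le> \<delta> / \<rho>1" using Suc.prems(5) \<rho>(3) by (simp add: field_simps)
    also have "\<dots> \<le> \<delta> / r e" using re Suc.prems by (intro divide_left_mono) auto
    finally have "\<rho>1 ^ n \<le> \<delta> / r e" .
    moreover have "0 < \<delta> / r e" "\<delta> / r e \<le> 1" "head G e \<in> verts G"
      using re False Suc.prems(3) e(1) by auto
    ultimately obtain p k where p: "awalk (head G e) p k" "y \<in> S p ` K k"
      "\<rho>0 * (\<delta> / r e) \<le> ratio p" "ratio p \<le> \<delta> / r e"
      using Suc.IH[of "head G e" y "\<delta> / r e", OF _ e(3)] by metis
    have "awalk i (e # p) k" "x \<in> S (e # p) ` K k"
      using e p(1,2) by (auto simp: awalk_Cons_iff)
    moreover have "\<rho>0 * \<delta> \<le> ratio (e # p)" "ratio (e # p) \<le> \<delta>"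
      using mult_left_mono[OF p(3), of "r e"] mult_left_mono[OF p(4), of "r e"] re(1) by simp_all
    ultimately show ?thesis by (intro exI[of _ "e # p"] exI[of _ k]) simp
  qed
qed

section \<open>Packing disjoint cycles\<close>

lemma S_image_ne: "j \<in> verts G \<Longrightarrow> S p ` K j \<noteq> {}"
  using K_ne by auto

lemma walk_exists: "i \<in> verts G \<Longrightarrow> k \<in> verts G \<Longrightarrow> \<exists>p. awalk i p k"
  using connected unfolding strongly_connected_def reachable_awalk by blast

lemma return_walks:
  assumes "j \<in> verts G"
  obtains b \<beta> where "\<And>k. k \<in> verts G \<Longrightarrow> awalk k (b k) j" "0 < \<beta>"
    "\<And>k. k \<in> verts G \<Longrightarrow> \<beta> \<le> ratio (b k)"
proof -
  have "\<forall>k\<in>verts G. \<exists>p. awalk k p j"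
    using walk_exists[OF _ assms] by blast
  then obtain b where b: "\<And>k. k \<in> verts G \<Longrightarrow> awalk k (b k) j" by metis
  let ?R = "insert 1 ((\<lambda>k. ratio (b k)) ` verts G)"
  have "0 < Min ?R"
    using b ratio_pos by (auto simp: awalk_def)
  moreover have "Min ?R \<le> ratio (b k)" if "k \<in> verts G" for k
    using that by auto
  ultimately show thesis using that b by blast
qed

text \<open>
  Every point \<open>x\<close> of a separated net of \<open>K j\<close> lies in the cylinder of a walk of ratio about \<open>\<delta>\<close>.
  Separation by twice the cylinder diameter makes these cylinders disjoint, and each walk is closed up
  to a cycle by one of finitely many return walks, which costs a constant factor.
\<close>

lemma cycle_packing:
  assumes j: "j \<in> verts G"
  obtains c C where "0 < c" "c \<le> 1" "0 < C"
    "\<And>\<delta>. 0 < \<delta> \<Longrightarrow> \<delta> \<le> 1 \<Longrightarrow> \<exists>P F. finite P \<and> P \<subseteq> directed_cycles G j \<and>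
        disjoint_family_on (\<lambda>p. S p ` K j) P \<and> (\<forall>p\<in>P. c * \<delta> \<le> ratio p) \<and>
        finite F \<and> card F \<le> card P \<and> K j \<subseteq> \<Union>F \<and> (\<forall>U\<in>F. bounded U \<and> diameter U \<le> C * \<delta>)"
proof -
  obtain M where M: "0 < M" "\<And>i x y. i \<in> verts G \<Longrightarrow> x \<in> K i \<Longrightarrow> y \<in> K i \<Longrightarrow> dist x y \<le> M"
    using common_diameter_bound by blast
  obtain \<rho>0 \<rho>1 where \<rho>: "0 < \<rho>0" "0 < \<rho>1" "\<rho>1 < 1" "\<And>e. e \<in> arcs G \<Longrightarrow> \<rho>0 \<le> r e \<and> r e \<le> \<rho>1"
    using arc_ratio_bounds by blast
  obtain b \<beta> where b: "\<And>k. k \<in> verts G \<Longrightarrow> awalk k (b k) j" and \<beta>: "0 < \<beta>"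
    "\<And>k. k \<in> verts G \<Longrightarrow> \<beta> \<le> ratio (b k)"
    using return_walks[OF j] by blast
  define c where "c = min 1 (\<rho>0 * \<beta>)"
  have c: "0 < c" "c \<le> 1" "c \<le> \<rho>0 * \<beta>" using \<rho>(1) \<beta>(1) by (auto simp: c_def)
  have "\<exists>P F. finite P \<and> P \<subseteq> directed_cycles G j \<and>
        disjoint_family_on (\<lambda>p. S p ` K j) P \<and> (\<forall>p\<in>P. c * \<delta> \<le> ratio p) \<and>
        finite F \<and> card F \<le> card P \<and> K j \<subseteq> \<Union>F \<and> (\<forall>U\<in>F. bounded U \<and> diameter U \<le> (8 * M) * \<delta>)"
    if \<delta>: "0 < \<delta>" "\<delta> \<le> 1" for \<delta>
  proof -
    have "0 < 2 * M * \<delta>" using M(1) \<delta> by simp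
    then obtain E where E: "finite E" "E \<subseteq> K j" "\<forall>x\<in>E. \<forall>y\<in>E. x \<noteq> y \<longrightarrow> 2 * M * \<delta> < dist x y"
      "K j \<subseteq> (\<Union>x\<in>E. cball x (2 * (2 * M * \<delta>)))"
      by (rule compact_separated_net[OF compact_K[OF j]])
    obtain n where n: "\<rho>1 ^ n \<le> \<delta>"
      using real_arch_pow_inv[OF \<delta>(1) \<rho>(3)] by (auto intro: less_imp_le)
    have "\<forall>x\<in>E. \<exists>p k. awalk j p k \<and> p \<noteq> [] \<and> x \<in> S p ` K k \<and> \<rho>0 * \<delta> \<le> ratio p \<and> ratio p \<le> \<delta>"
      using walk_of_comparable_ratio[OF \<rho>(1,4,2) j _ \<delta> n] E(2) by blast
    then obtain p k where p: "\<And>x. x \<in> E \<Longrightarrow> awalk j (p x) (k x)" "\<And>x. x \<in> E \<Longrightarrow> p x \<noteq> []"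
      "\<And>x. x \<in> E \<Longrightarrow> x \<in> S (p x) ` K (k x)"
      "\<And>x. x \<in> E \<Longrightarrow> \<rho>0 * \<delta> \<le> ratio (p x)" "\<And>x. x \<in> E \<Longrightarrow> ratio (p x) \<le> \<delta>"
      by metis
    have k: "k x \<in> verts G" if "x \<in> E" for x using p(1)[OF that] by auto
    define g where "g x = p x @ b (k x)" for x
    have near: "dist x z \<le> M * \<delta>" if x: "x \<in> E" and z: "z \<in> S (g x) ` K j" for x z
    proof -
      have "S (b (k x)) ` K j \<subseteq> K (k x)" by (rule S_image_subset[OF b[OF k[OF x]]])
      then obtain z' where z': "z' \<in> K (k x)" "z = S (p x) z'"
        using z by (auto simp: g_def)
      obtain x' where x': "x' \<in> K (k x)" "x = S (p x) x'" using p(3)[OF x] by blast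
      have "set (p x) \<subseteq> arcs G" using p(1)[OF x] by (simp add: awalk_def)
      from dist_S[OF this, of x' z'] have "dist x z = ratio (p x) * dist x' z'"
        using x'(2) z'(2) by simp
      also have "\<dots> \<le> \<delta> * M"
        using p(5)[OF x] M(2)[OF k[OF x] x'(1) z'(1)] \<delta> by (intro mult_mono) auto
      finally show ?thesis by (simp add: mult.commute)
    qed
    have disj: "S (g x) ` K j \<inter> S (g y) ` K j = {}" if xy: "x \<in> E" "y \<in> E" "x \<noteq> y" for x y
    proof (rule ccontr)
      assume "S (g x) ` K j \<inter> S (g y) ` K j \<noteq> {}"
      then obtain z where "z \<in> S (g x) ` K j" "z \<in> S (g y) ` K j" by blast
      then have "dist x z \<le> M * \<delta>" "dist y z \<le> M * \<delta>" using near xy by auto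
      then have "dist x y \<le> 2 * M * \<delta>" using dist_triangle2[of x y z] by simp
      then show False using E(3) xy by fastforce
    qed
    have inj: "inj_on g E"
      using disj S_image_ne[OF j] by (metis Int_absorb inj_onI)
    have cyc: "g ` E \<subseteq> directed_cycles G j"
      using p(1,2) b[OF k] by (auto simp: directed_cycles_def g_def intro: awalk_appendI)
    have rat: "c * \<delta> \<le> ratio (g x)" if x: "x \<in> E" for x
    proof -
      have "c * \<delta> \<le> (\<rho>0 * \<beta>) * \<delta>" using c(3) \<delta> by (intro mult_right_mono) auto
      also have "\<dots> = (\<rho>0 * \<delta>) * \<beta>" by simp
      also have "\<dots> \<le> ratio (p x) * ratio (b (k x))"
      proof (intro mult_mono p(4)[OF x] \<beta>(2) k[OF x])
        show "0 \<le> ratio (p x)" using ratio_pos p(1)[OF x] by (auto simp: awalk_def less_imp_le)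
      qed (use \<beta> in auto)
      finally show ?thesis by (simp add: g_def)
    qed
    have dfam: "disjoint_family_on (\<lambda>p. S p ` K j) (g ` E)"
      using disj unfolding disjoint_family_on_def by blast
    let ?F = "(\<lambda>x. cball x (2 * (2 * M * \<delta>))) ` E"
    have "card ?F \<le> card (g ` E)"
      by (simp add: card_image[OF inj] card_image_le[OF E(1)])
    moreover have "\<forall>U\<in>?F. bounded U \<and> diameter U \<le> (8 * M) * \<delta>"
      using M(1) \<delta> by auto
    moreover have "\<forall>p\<in>g ` E. c * \<delta> \<le> ratio p" using rat by blast
    ultimately show ?thesis
      using E(1,4) cyc dfam by (intro exI[of _ "g ` E"] exI[of _ ?F] conjI) (assumption | simp)+
  qed
  moreover have "0 < 8 * M" using M(1) by simp
  ultimately show thesis by (intro that[OF c(1,2)])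
qed

lemma finite_level_covers:
  assumes M: "\<And>i x y. i \<in> verts G \<Longrightarrow> x \<in> K i \<Longrightarrow> y \<in> K i \<Longrightarrow> dist x y \<le> M" and "0 < M"
    and \<rho>: "\<And>e. e \<in> arcs G \<Longrightarrow> r e \<le> \<rho>" and "i \<in> verts G"
  shows "\<exists>F. finite F \<and> card F \<le> card (arcs G) ^ n \<and> K i \<subseteq> \<Union>F \<and>
           (\<forall>U\<in>F. \<forall>x\<in>U. \<forall>y\<in>U. dist x y \<le> M * \<rho> ^ n)"
  using \<open>i \<in> verts G\<close>
proof (induction n arbitrary: i)
  case 0
  then show ?case using M by (intro exI[of _ "{K i}"]) auto
next
  case (Suc n)
  let ?s = "\<lambda>e. similarity_map (r e) (T e) (v e)"
  have "\<forall>k\<in>verts G. \<exists>F. finite F \<and> card F \<le> card (arcs G) ^ n \<and> K k \<subseteq> \<Union>F \<and>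
           (\<forall>U\<in>F. \<forall>x\<in>U. \<forall>y\<in>U. dist x y \<le> M * \<rho> ^ n)"
    using Suc.IH by blast
  then obtain F where F: "\<And>k. k \<in> verts G \<Longrightarrow> finite (F k)"
    "\<And>k. k \<in> verts G \<Longrightarrow> card (F k) \<le> card (arcs G) ^ n" "\<And>k. k \<in> verts G \<Longrightarrow> K k \<subseteq> \<Union>(F k)"
    "\<And>k U x y. k \<in> verts G \<Longrightarrow> U \<in> F k \<Longrightarrow> x \<in> U \<Longrightarrow> y \<in> U \<Longrightarrow> dist x y \<le> M * \<rho> ^ n"
    by metis
  let ?F = "\<Union>e\<in>arcs G. (`) (?s e) ` F (head G e)"
  have fin: "finite ?F" by (intro finite_UN_I finite_imageI F(1)) auto
  have "card ?F \<le> (\<Sum>e\<in>arcs G. card ((`) (?s e) ` F (head G e)))"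
    by (rule card_UN_le) simp
  also have "\<dots> \<le> (\<Sum>e\<in>arcs G. card (arcs G) ^ n)"
    using F(1,2) head_in_verts by (intro sum_mono) (meson card_image_le order_trans)
  finally have card: "card ?F \<le> card (arcs G) ^ Suc n" by simp
  have cover: "K i \<subseteq> \<Union>?F"
  proof
    fix x assume "x \<in> K i"
    then obtain e y where e: "e \<in> arcs G" "y \<in> K (head G e)" "x = ?s e y"
      using K_unfold[OF Suc.prems] by auto
    then obtain U where "U \<in> F (head G e)" "y \<in> U" using F(3)[of "head G e"] by auto
    then show "x \<in> \<Union>?F" using e by blast
  qed
  have "dist x y \<le> M * \<rho> ^ Suc n" if "U \<in> ?F" "x \<in> U" "y \<in> U" for U x y
  proof -
    obtain e V where e: "e \<in> arcs G" "V \<in> F (head G e)" "U = ?s e ` V" using \<open>U \<in> ?F\<close> by blast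
    then obtain x' y' where x': "x' \<in> V" "y' \<in> V" "x = ?s e x'" "y = ?s e y'" using \<open>x \<in> U\<close> \<open>y \<in> U\<close> by blast
    have "dist x y = r e * dist x' y'" using x' dist_similarity_map[OF data[OF e(1)]] by simp
    also have "\<dots> \<le> \<rho> * (M * \<rho> ^ n)"
      using F(4)[OF _ e(2) x'(1,2)] e(1) \<rho>[OF e(1)] arc_ratio[OF e(1)] by (intro mult_mono) auto
    finally show ?thesis by (simp add: mult_ac)
  qed
  with fin card cover show ?case by (intro exI[of _ ?F]) blast
qed

text \<open>
  The exponent \<open>u\<close> is chosen so large that the geometric growth of the number of cylinders at level \<open>n\<close>
  loses against the decay of the \<open>u\<close>-th powers of their diameters. It witnesses that the infima defining
  the Hausdorff dimensions of \<open>K i\<close> and of its subsets range over nonempty sets.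
\<close>

lemma hausdorff_measure_K_vanishes:
  assumes "i \<in> verts G"
  obtains u where "0 \<le> u" "hausdorff_measure u (K i) = 0"
proof -
  obtain M where M: "0 < M" "\<And>i x y. i \<in> verts G \<Longrightarrow> x \<in> K i \<Longrightarrow> y \<in> K i \<Longrightarrow> dist x y \<le> M"
    using common_diameter_bound by blast
  obtain \<rho>0 \<rho> where \<rho>: "0 < \<rho>0" "0 < \<rho>" "\<rho> < 1" "\<And>e. e \<in> arcs G \<Longrightarrow> \<rho>0 \<le> r e \<and> r e \<le> \<rho>"
    using arc_ratio_bounds by blast
  obtain n where n: "\<rho> ^ n < 1 / (real (card (arcs G)) + 1)"
    using real_arch_pow_inv[of "1 / (real (card (arcs G)) + 1)" \<rho>] \<rho> by auto
  define u where "u = real (Suc n)"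
  have "\<rho> powr u \<le> \<rho> ^ n"
    unfolding u_def using \<rho> by (simp only: powr_realpow) (simp add: mult_left_le_one_le)
  then have "real (card (arcs G)) * \<rho> powr u \<le> real (card (arcs G)) * \<rho> ^ n"
    by (rule mult_left_mono) simp
  also have "\<dots> \<le> real (card (arcs G)) * (1 / (real (card (arcs G)) + 1))"
    using n by (intro mult_left_mono) auto
  also have "\<dots> < 1" by (simp add: field_simps)
  finally have less1: "real (card (arcs G)) * \<rho> powr u < 1" .
  have "hausdorff_measure u (K i) = 0"
  proof (rule hausdorff_measure_eq_0_if_geometric_covers[where a = 1 and b = M and \<beta> = \<rho>])
    show "real (card (arcs G)) * \<rho> powr u < 1" by (rule less1)
    fix k
    have "\<exists>F. finite F \<and> card F \<le> card (arcs G) ^ k \<and> K i \<subseteq> \<Union>F \<and>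
        (\<forall>U\<in>F. \<forall>x\<in>U. \<forall>y\<in>U. dist x y \<le> M * \<rho> ^ k)"
      by (rule finite_level_covers) (use M \<rho>(4) assms in auto)
    then obtain F where F: "finite F" "card F \<le> card (arcs G) ^ k" "K i \<subseteq> \<Union>F"
      "\<forall>U\<in>F. \<forall>x\<in>U. \<forall>y\<in>U. dist x y \<le> M * \<rho> ^ k"
      by blast
    have "\<forall>U\<in>F. bounded U \<and> diameter U \<le> M * \<rho> ^ k"
    proof (intro ballI conjI)
      fix U assume "U \<in> F"
      then have U: "dist x y \<le> M * \<rho> ^ k" if "x \<in> U" "y \<in> U" for x y
        using F(4) that by blast
      show "bounded U"
        using U unfolding bounded_def by (cases "U = {}") blast+
      show "diameter U \<le> M * \<rho> ^ k"
        using U M(1) \<rho>(2) by (intro diameter_le) (auto simp: dist_norm)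
    qed
    moreover have "real (card F) \<le> 1 * real (card (arcs G)) ^ k"
      using F(2) by (simp flip: of_nat_power)
    ultimately show "\<exists>F. finite F \<and> real (card F) \<le> 1 * real (card (arcs G)) ^ k \<and> K i \<subseteq> \<Union>F \<and>
        (\<forall>U\<in>F. bounded U \<and> diameter U \<le> M * \<rho> ^ k)"
      using F(1,3) by (intro exI[of _ F] conjI)
  qed (use \<rho> M(1) in \<open>auto simp: u_def\<close>)
  then show thesis using that[of u] by (simp add: u_def)
qed

text \<open>
  One cycle \<open>a\<close> can be spared, because it is needed to adjust the group. For \<open>t = 0\<close> the sum condition
  only asks for two disjoint cycles, which exist at every scale that is
  small compared with the distance of \<open>x\<close> and \<open>y\<close>.
\<close>

lemma disjoint_cycles_of_large_sum:
  assumes j: "j \<in> verts G" and xy: "x \<in> K j" "y \<in> K j" "x \<noteq> y"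
    and t: "t = 0 \<or> 0 < t \<and> t < hausdorff_dim (K j)"
  obtains P where "finite P" "P \<subseteq> directed_cycles G j" "disjoint_family_on (\<lambda>p. S p ` K j) P"
    "2 \<le> card P" "\<forall>a\<in>P. 1 \<le> (\<Sum>p\<in>P - {a}. ratio p powr t)"
proof -
  obtain c C where c: "0 < c" "c \<le> 1" "0 < C"
    and packing: "\<And>\<delta>. 0 < \<delta> \<Longrightarrow> \<delta> \<le> 1 \<Longrightarrow> \<exists>P F. finite P \<and> P \<subseteq> directed_cycles G j \<and>
        disjoint_family_on (\<lambda>p. S p ` K j) P \<and> (\<forall>p\<in>P. c * \<delta> \<le> ratio p) \<and>
        finite F \<and> card F \<le> card P \<and> K j \<subseteq> \<Union>F \<and> (\<forall>U\<in>F. bounded U \<and> diameter U \<le> C * \<delta>)"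
    using cycle_packing[OF j] by blast
  have "\<exists>\<delta> P. 0 < \<delta> \<and> finite P \<and> P \<subseteq> directed_cycles G j \<and> disjoint_family_on (\<lambda>p. S p ` K j) P \<and>
      (\<forall>p\<in>P. c * \<delta> \<le> ratio p) \<and> 2 \<le> card P \<and> 1 \<le> (real (card P) - 1) * (c * \<delta>) powr t"
  proof (cases "t = 0")
    case True
    define \<delta> where "\<delta> = min 1 (dist x y / (2 * C))"
    have \<delta>: "0 < \<delta>" "\<delta> \<le> 1" "C * \<delta> < dist x y"
    proof -
      have "C * \<delta> \<le> C * (dist x y / (2 * C))"
        using c by (intro mult_left_mono) (auto simp: \<delta>_def)
      also have "\<dots> < dist x y" using c xy by simp
      finally show "C * \<delta> < dist x y" .
    qed (use xy c in \<open>auto simp: \<delta>_def\<close>)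
    obtain P F where P: "finite P" "P \<subseteq> directed_cycles G j" "disjoint_family_on (\<lambda>p. S p ` K j) P"
      "\<forall>p\<in>P. c * \<delta> \<le> ratio p" and F: "finite F" "card F \<le> card P" "K j \<subseteq> \<Union>F"
      "\<forall>U\<in>F. bounded U \<and> diameter U \<le> C * \<delta>"
      using packing[OF \<delta>(1,2)] by blast
    have "\<not> card F \<le> 1"
    proof
      assume "card F \<le> 1"
      then have "\<forall>U\<in>F. \<forall>V\<in>F. U = V" using F(1) by (metis One_nat_def card_le_Suc0_iff_eq)
      moreover obtain U V where "U \<in> F" "x \<in> U" "V \<in> F" "y \<in> V" using F(3) xy by blast
      ultimately have "U \<in> F" "x \<in> U" "y \<in> U" by auto
      then have "dist x y \<le> C * \<delta>" using F(4) diameter_bounded_bound by (metis order_trans)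
      then show False using \<delta>(3) by simp
    qed
    then show ?thesis
      using P F(2) True \<delta>(1) c by (intro exI[of _ \<delta>] exI[of _ P]) auto
  next
    case False
    with t have t: "0 < t" "t < hausdorff_dim (K j)" by auto
    show ?thesis
    proof (rule ccontr)
      assume none: "\<not> ?thesis"
      \<comment> \<open>With few cycles at every scale, the covers by as many sets give measure \<open>0\<close> in dimension \<open>s\<close>.\<close>
      define s where "s = (t + hausdorff_dim (K j)) / 2"
      have s: "0 < s" "t < s" "s < hausdorff_dim (K j)" using t by (auto simp: s_def)
      have "hausdorff_measure s (K j) = 0"
      proof (rule hausdorff_measure_eq_0_if_geometric_covers[where a = "2 * c powr (-t)" and b = C
            and \<beta> = "1/2" and \<alpha> = "2 powr t"])
        have "2 powr t * (1 / 2) powr s = 2 powr (t - s)"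
          by (simp add: powr_divide powr_diff)
        also have "\<dots> < 2 powr 0" using s by (intro powr_less_mono) auto
        finally show "2 powr t * (1 / 2) powr s < (1::real)" by simp
        fix k
        define \<delta> where "\<delta> = (1/2::real) ^ k"
        have \<delta>: "0 < \<delta>" "\<delta> \<le> 1" by (auto simp: \<delta>_def power_le_one)
        obtain P F where P: "finite P" "P \<subseteq> directed_cycles G j" "disjoint_family_on (\<lambda>p. S p ` K j) P"
          "\<forall>p\<in>P. c * \<delta> \<le> ratio p" and F: "finite F" "card F \<le> card P" "K j \<subseteq> \<Union>F"
          "\<forall>U\<in>F. bounded U \<and> diameter U \<le> C * \<delta>"
          using packing[OF \<delta>] by blast
        have cd: "0 < c * \<delta>" "c * \<delta> \<le> 1" using c \<delta> by (auto intro: mult_le_one)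
        have pos: "0 < (c * \<delta>) powr t" "(c * \<delta>) powr t \<le> 1"
          using cd t by (auto simp: powr_le1)
        have small: "(real (card P) - 1) * (c * \<delta>) powr t \<le> 1"
        proof (rule ccontr)
          assume big: "\<not> ?thesis"
          have "2 \<le> card P"
          proof (rule ccontr)
            assume "\<not> 2 \<le> card P"
            then have "(real (card P) - 1) * (c * \<delta>) powr t \<le> 0"
              using pos by (intro mult_nonpos_nonneg) auto
            then show False using big by simp
          qed
          moreover have "1 \<le> (real (card P) - 1) * (c * \<delta>) powr t" using big by simp
          ultimately have "0 < \<delta> \<and> finite P \<and> P \<subseteq> directed_cycles G j \<and>
              disjoint_family_on (\<lambda>p. S p ` K j) P \<and> (\<forall>p\<in>P. c * \<delta> \<le> ratio p) \<and> 2 \<le> card P \<and>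
              1 \<le> (real (card P) - 1) * (c * \<delta>) powr t"
            using \<delta>(1) P by (intro conjI)
          with none show False by (elim notE) (intro exI)
        qed
        have "real (card P) \<le> 2 * (c * \<delta>) powr (-t)"
        proof -
          have "real (card P) * (c * \<delta>) powr t \<le> 2"
            using small pos by (simp add: algebra_simps)
          then show ?thesis using pos by (simp add: powr_minus field_simps)
        qed
        also have "(c * \<delta>) powr (-t) = c powr (-t) * (2 powr t) ^ k"
        proof -
          have "\<delta> powr (-t) = (2 powr t) ^ k"
            by (simp add: \<delta>_def powr_minus power_one_over powr_divide powr_power powr_realpow[symmetric]
                powr_powr mult.commute)
          then show ?thesis using c \<delta> by (simp add: powr_mult)
        qed
        finally have "real (card F) \<le> 2 * c powr (-t) * (2 powr t) ^ k" using F(2) by simp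
        then show "\<exists>F. finite F \<and> real (card F) \<le> 2 * c powr (-t) * (2 powr t) ^ k \<and> K j \<subseteq> \<Union>F \<and>
            (\<forall>U\<in>F. bounded U \<and> diameter U \<le> C * (1/2) ^ k)"
          using F unfolding \<delta>_def by blast
      qed (use s c in auto)
      then have "hausdorff_dim (K j) \<le> s" using s by (intro hausdorff_dim_le) auto
      then show False using s by simp
    qed
  qed
  then obtain \<delta> P where \<delta>: "0 < \<delta>" and P: "finite P" "P \<subseteq> directed_cycles G j"
    "disjoint_family_on (\<lambda>p. S p ` K j) P" "\<And>p. p \<in> P \<Longrightarrow> c * \<delta> \<le> ratio p" "2 \<le> card P"
    "1 \<le> (real (card P) - 1) * (c * \<delta>) powr t" by blast
  have "1 \<le> (\<Sum>p\<in>P - {a}. ratio p powr t)" if "a \<in> P" for a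
  proof -
    have "(real (card P) - 1) * (c * \<delta>) powr t = (\<Sum>p\<in>P - {a}. (c * \<delta>) powr t)"
      using P(1,5) that by (simp add: card_Diff_singleton of_nat_diff)
    also have "\<dots> \<le> (\<Sum>p\<in>P - {a}. ratio p powr t)"
      using P(4) c \<delta> t by (intro sum_mono powr_mono2) auto
    finally show ?thesis using P(6) by simp
  qed
  then have "\<forall>a\<in>P. 1 \<le> (\<Sum>p\<in>P - {a}. ratio p powr t)" by blast
  then show thesis by (rule that[OF P(1,2,3,5)])
qed

section \<open>Finitely many disjoint cycles that generate the transformation group\<close>

text \<open>
  The subgroup generated by \<open>W\<close>, pulled back to walks, so that its product is concatenation. The walks
  are arbitrary lists of arcs, so that they can be cut at any place.
\<close>

definition generated_walks :: "'e list set \<Rightarrow> 'e list set" where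
  "generated_walks W =
     {p. set p \<subseteq> arcs G \<and> path_matrix T p \<in> generate orthogonal_group (path_matrix T ` W)}"

lemma generate_subgroup:
  assumes "W \<subseteq> lists (arcs G)"
  shows "subgroup (generate orthogonal_group (path_matrix T ` W)) orthogonal_group"
proof (rule group.generate_is_subgroup[OF group_orthogonal_group])
  show "path_matrix T ` W \<subseteq> carrier orthogonal_group"
    using assms orthogonal_path_matrix by (auto simp: orthogonal_group_def lists_eq_set)
qed

lemma generated_walks_incl: "p \<in> W \<Longrightarrow> set p \<subseteq> arcs G \<Longrightarrow> p \<in> generated_walks W"
  by (auto simp: generated_walks_def intro: generate.incl)

lemma generated_walks_Nil: "[] \<in> generated_walks W"
  using generate.one[of orthogonal_group "path_matrix T ` W"]
  by (simp add: generated_walks_def orthogonal_group_def)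

lemma generated_walks_append:
  assumes "p \<in> generated_walks W" "p' \<in> generated_walks W"
  shows "p @ p' \<in> generated_walks W"
  using assms generate.eng[of "path_matrix T p" orthogonal_group "path_matrix T ` W" "path_matrix T p'"]
  by (simp add: generated_walks_def orthogonal_group_def)

lemma generated_walks_mono: "W \<subseteq> W' \<Longrightarrow> generated_walks W \<subseteq> generated_walks W'"
  using group.mono_generate[OF group_orthogonal_group, of "path_matrix T ` W" "path_matrix T ` W'"]
  by (auto simp: generated_walks_def image_mono)

lemma generated_walks_splice:
  assumes W: "W \<subseteq> lists (arcs G)"
    and xy: "x @ y \<in> generated_walks W" and zy: "z @ y \<in> generated_walks W"
    and zw: "z @ w \<in> generated_walks W"
  shows "x @ w \<in> generated_walks W"
proof -
  have sets: "set x \<subseteq> arcs G" "set y \<subseteq> arcs G" "set z \<subseteq> arcs G" "set w \<subseteq> arcs G"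
    using xy zw by (auto simp: generated_walks_def)
  have "path_matrix T x \<otimes>\<^bsub>orthogonal_group\<^esub> path_matrix T w
      \<in> generate orthogonal_group (path_matrix T ` W)"
    by (rule group.subgroup_splice[OF group_orthogonal_group generate_subgroup[OF W],
          where y = "path_matrix T y" and z = "path_matrix T z"])
       (use xy zy zw sets orthogonal_path_matrix in
         \<open>auto simp: generated_walks_def orthogonal_group_def\<close>)
  then show ?thesis
    using sets by (simp add: generated_walks_def orthogonal_group_def)
qed

lemma directed_cycles_lists: "directed_cycles G j \<subseteq> lists (arcs G)"
  by (auto simp: directed_cycles_def awalk_def)

lemma directed_cycles_append:
  "p \<in> directed_cycles G j \<Longrightarrow> p' \<in> directed_cycles G j \<Longrightarrow> p @ p' \<in> directed_cycles G j"
  by (auto simp: directed_cycles_def intro: awalk_appendI)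

lemma cycle_image_subset: "p \<in> directed_cycles G j \<Longrightarrow> S p ` K j \<subseteq> K j"
  by (auto simp: directed_cycles_def dest: S_image_subset)

text \<open>
  As for the fundamental group of a graph with a spanning tree: with fixed walks \<open>a i\<close> from \<open>j\<close> to \<open>i\<close>
  and \<open>b i\<close> back, every cycle is a product of cycles \<open>a (tail G e) @ [e] @ b (head G e)\<close> and of inverses
  of cycles \<open>a i @ b i\<close>. The walks \<open>a j\<close> and \<open>b j\<close> are empty so that a cycle at \<open>j\<close> is not altered.
\<close>

lemma finitely_many_generating_cycles:
  assumes j: "j \<in> verts G"
  obtains C where "finite C" "C \<subseteq> directed_cycles G j" "directed_cycles G j \<subseteq> generated_walks C"
proof -
  have "\<forall>i\<in>verts G. \<exists>p. awalk j p i \<and> (i = j \<longrightarrow> p = [])"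
  proof
    fix i assume "i \<in> verts G"
    then obtain p where "awalk j p i" using walk_exists[OF j] by blast
    then show "\<exists>p. awalk j p i \<and> (i = j \<longrightarrow> p = [])"
      using j by (cases "i = j") (auto simp: awalk_Nil_iff)
  qed
  then obtain a where a: "\<forall>i\<in>verts G. awalk j (a i) i" and aj: "a j = []" using j by metis
  have "\<forall>i\<in>verts G. \<exists>p. awalk i p j \<and> (i = j \<longrightarrow> p = [])"
  proof
    fix i assume "i \<in> verts G"
    then obtain p where "awalk i p j" using walk_exists[OF _ j] by blast
    then show "\<exists>p. awalk i p j \<and> (i = j \<longrightarrow> p = [])"
      using j by (cases "i = j") (auto simp: awalk_Nil_iff)
  qed
  then obtain b where b: "\<forall>i\<in>verts G. awalk i (b i) j" and bj: "b j = []" using j by metis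
  define L where "L = (\<lambda>i. a i @ b i) ` verts G \<union>
    (\<lambda>e. a (tail G e) @ [e] @ b (head G e)) ` arcs G"
  define C where "C = L - {[]}"
  have "finite C" by (simp add: C_def L_def)
  have L_walk: "awalk j p j" if p: "p \<in> L" for p
  proof -
    consider i where "i \<in> verts G" "p = a i @ b i"
      | e where "e \<in> arcs G" "p = a (tail G e) @ [e] @ b (head G e)"
      using p by (auto simp: L_def)
    then show ?thesis
    proof cases
      case 1
      then show ?thesis using a b by (auto intro: awalk_appendI)
    next
      case 2
      have "awalk (tail G e) [e] (head G e)"
        using 2(1) by (simp add: awalk_Cons_iff awalk_Nil_iff)
      then show ?thesis
        unfolding 2(2) using 2(1) a b by (intro awalk_appendI[of j _ "tail G e"] awalk_appendI[of "tail G e" _ "head G e"]) auto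
    qed
  qed
  then have C: "C \<subseteq> directed_cycles G j" by (auto simp: C_def directed_cycles_def)
  have C_lists: "C \<subseteq> lists (arcs G)" using C directed_cycles_lists by blast
  have L_gen: "p \<in> generated_walks C" if "p \<in> L" for p
    using that L_walk[OF that] generated_walks_Nil generated_walks_incl[of p C]
    by (cases "p = []") (auto simp: C_def awalk_def)
  have ab: "a i @ b i \<in> generated_walks C" if "i \<in> verts G" for i
    using that by (intro L_gen) (auto simp: L_def)
  have "a i @ p @ b k \<in> generated_walks C" if "awalk i p k" for i p k
    using that
  proof (induction p arbitrary: i)
    case Nil
    then show ?case using ab by (auto simp: awalk_Nil_iff)
  next
    case (Cons e p)
    then have e: "e \<in> arcs G" "tail G e = i" "awalk (head G e) p k" "i \<in> verts G"
      by (auto simp: awalk_Cons_iff)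
    let ?h = "head G e"
    have h: "?h \<in> verts G" using e(1) by simp
    have IH: "a ?h @ p @ b k \<in> generated_walks C" by (rule Cons.IH[OF e(3)])
    have first: "a i @ [e] @ b ?h \<in> generated_walks C"
      using e(1,2) by (intro L_gen) (auto simp: L_def)
    \<comment> \<open>In \<open>first\<close> followed by \<open>IH\<close>, the detour \<open>b ?h @ a ?h\<close> is cancelled against \<open>a ?h @ b ?h\<close>.\<close>
    have "(a i @ [e]) @ p @ b k \<in> generated_walks C"
      by (rule generated_walks_splice[OF C_lists, of _ "b ?h" "a ?h"]) (use first ab[OF h] IH in simp_all)
    then show ?case by simp
  qed
  then have "directed_cycles G j \<subseteq> generated_walks C"
    using aj bj by (force simp: directed_cycles_def)
  with \<open>finite C\<close> C show thesis by (rule that)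
qed

text \<open>
  The cylinders of \<open>u @ x\<close> and \<open>u @ y\<close> lie in the cylinder of \<open>u\<close>, and they are disjoint because \<open>S u\<close>
  is injective.
\<close>

lemma disjoint_cycles_split:
  assumes j: "j \<in> verts G" and W: "disjoint_family_on (\<lambda>p. S p ` K j) (insert u W)" "u \<notin> W"
    and u: "u \<in> directed_cycles G j" and x: "x \<in> directed_cycles G j" and y: "y \<in> directed_cycles G j"
    and xy: "S x ` K j \<inter> S y ` K j = {}"
  shows "disjoint_family_on (\<lambda>p. S p ` K j) (insert (u @ y) (insert (u @ x) W))"
    and "u @ y \<notin> insert (u @ x) W" "u @ x \<notin> W"
proof -
  let ?D = "\<lambda>p. S p ` K j"
  have "set u \<subseteq> arcs G" using u by (auto simp: directed_cycles_def awalk_def)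
  have D: "?D (u @ z) = S u ` ?D z" for z by (simp add: image_image)
  have sub: "?D (u @ z) \<subseteq> ?D u" if "z \<in> directed_cycles G j" for z
    using cycle_image_subset[OF that] by (simp only: D image_mono)
  have xy': "?D (u @ x) \<inter> ?D (u @ y) = {}"
    using xy inj_S[OF \<open>set u \<subseteq> arcs G\<close>] by (simp only: D image_Int[symmetric]) simp
  have wu: "?D w \<inter> ?D u = {}" if "w \<in> W" for w
    using that W disjoint_family_onD[OF W(1), of w u] by blast
  have ww: "?D w \<inter> ?D w' = {}" if "w \<in> W" "w' \<in> W" "w \<noteq> w'" for w w'
    using that disjoint_family_onD[OF W(1), of w w'] by blast
  have wx: "?D w \<inter> ?D (u @ x) = {}" "?D w \<inter> ?D (u @ y) = {}" if "w \<in> W" for w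
    using wu[OF that] sub[OF x] sub[OF y] by blast+
  show "disjoint_family_on ?D (insert (u @ y) (insert (u @ x) W))"
    unfolding disjoint_family_on_def
    using xy' ww wx by (simp only: ball_simps Int_commute) blast
  have "?D (u @ z) \<noteq> {}" for z by (rule S_image_ne[OF j])
  then show "u @ y \<notin> insert (u @ x) W" "u @ x \<notin> W"
    using wx xy' by blast+
qed

text \<open>
  Two disjoint cycles \<open>a\<close> and \<open>b\<close> provide infinitely many disjoint cylinders \<open>a\<^sup>k b\<close>, inside which the
  cycles of \<open>C\<close> are placed one at a time.
\<close>

lemma disjoint_cycles_with_generators:
  assumes j: "j \<in> verts G" and P: "finite P" "P \<subseteq> directed_cycles G j"
    "disjoint_family_on (\<lambda>p. S p ` K j) P"
    and ab: "a \<in> P" "b \<in> P" "a \<noteq> b" and C: "finite C" "C \<subseteq> directed_cycles G j"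
  shows "\<exists>W. finite W \<and> W \<subseteq> directed_cycles G j \<and> disjoint_family_on (\<lambda>p. S p ` K j) W \<and>
    P - {a} \<subset> W \<and> C \<subseteq> generated_walks W"
proof -
  let ?disj = "disjoint_family_on (\<lambda>p. S p ` K j)"
  have a: "a \<in> directed_cycles G j" and b: "b \<in> directed_cycles G j" using P ab by auto
  have arcs: "set p \<subseteq> arcs G" if "p \<in> directed_cycles G j" for p
    using that by (auto simp: directed_cycles_def awalk_def)
  have cancel_left: "p' \<in> generated_walks W" if "W \<subseteq> directed_cycles G j"
    "p \<in> generated_walks W" "p @ p' \<in> generated_walks W" for W p p'
    using generated_walks_splice[of W "[]" "[]" p p'] generated_walks_Nil directed_cycles_lists[of j] that
    by auto
  have cancel_right: "p \<in> generated_walks W" if "W \<subseteq> directed_cycles G j"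
    "p' \<in> generated_walks W" "p @ p' \<in> generated_walks W" for W p p'
    using generated_walks_splice[of W p p' "[]" "[]"] generated_walks_Nil directed_cycles_lists[of j] that
    by auto
  have "S b ` K j \<inter> S a ` K j = {}"
    using disjoint_family_onD[OF P(3) ab(2,1)] ab(3) by simp
  \<comment> \<open>The cycle \<open>u\<close> marks a cylinder that is still unoccupied; it is split into \<open>u @ b @ c\<close>, which
    joins \<open>W\<close>, and \<open>u @ a\<close>, which takes the place of \<open>u\<close>.\<close>
  have "\<exists>W u. finite W \<and> W \<subseteq> directed_cycles G j \<and> u \<in> directed_cycles G j \<and> u \<notin> W \<and>
      ?disj (insert u W) \<and> P - {a} \<subset> W \<and> a \<in> generated_walks W \<and> u \<in> generated_walks W \<and>
      C \<subseteq> generated_walks W"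
    using C
  proof (induction C)
    case empty
    let ?W = "insert (a @ b) (P - {a})"
    have W: "?W \<subseteq> directed_cycles G j" using P(2) directed_cycles_append[OF a b] by auto
    have "insert a (P - {a}) = P" using ab by blast
    then have d: "?disj (insert (a @ a) ?W)" "a @ a \<notin> ?W" "a @ b \<notin> P - {a}"
      using disjoint_cycles_split[OF j, of a "P - {a}" b a] P(3) a b \<open>S b ` K j \<inter> S a ` K j = {}\<close>
      by auto
    have "b \<in> generated_walks ?W" using ab arcs[OF b] by (intro generated_walks_incl) auto
    moreover have "a @ b \<in> generated_walks ?W"
      using arcs[OF directed_cycles_append[OF a b]] by (intro generated_walks_incl) auto
    ultimately have ga: "a \<in> generated_walks ?W" by (rule cancel_right[OF W])
    then have "a @ a \<in> generated_walks ?W" by (intro generated_walks_append)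
    with W d ga P(1) directed_cycles_append[OF a a] show ?case
      by (intro exI[of _ ?W] exI[of _ "a @ a"]) auto
  next
    case (insert c C)
    then obtain W u where W: "finite W" "W \<subseteq> directed_cycles G j" "u \<in> directed_cycles G j" "u \<notin> W"
      "?disj (insert u W)" "P - {a} \<subset> W" "a \<in> generated_walks W" "u \<in> generated_walks W"
      "C \<subseteq> generated_walks W" by auto
    have c: "c \<in> directed_cycles G j" using insert.prems by simp
    have bc: "b @ c \<in> directed_cycles G j" by (rule directed_cycles_append[OF b c])
    have ubc: "u @ b @ c \<in> directed_cycles G j" by (rule directed_cycles_append[OF W(3) bc])
    let ?W = "insert (u @ b @ c) W"
    have W': "?W \<subseteq> directed_cycles G j" using W(2) ubc by simp
    have "S (b @ c) ` K j \<subseteq> S b ` K j"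
      using cycle_image_subset[OF c] by auto
    then have "S (b @ c) ` K j \<inter> S a ` K j = {}" using \<open>S b ` K j \<inter> S a ` K j = {}\<close> by blast
    then have d: "?disj (insert (u @ a) ?W)" "u @ a \<notin> ?W"
      using disjoint_cycles_split[OF j W(5,4,3) bc a] by auto
    have mono: "generated_walks W \<subseteq> generated_walks ?W" by (rule generated_walks_mono) auto
    have "b \<in> generated_walks ?W" using ab W(6) arcs[OF b] by (intro generated_walks_incl) auto
    then have "u @ b \<in> generated_walks ?W" using W(8) mono by (intro generated_walks_append) auto
    moreover have "(u @ b) @ c \<in> generated_walks ?W"
      using arcs[OF ubc] by (intro generated_walks_incl) auto
    ultimately have gc: "c \<in> generated_walks ?W" by (rule cancel_left[OF W'])
    have "u @ a \<in> generated_walks ?W" using W(7,8) mono by (intro generated_walks_append) auto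
    with W W' d gc mono directed_cycles_append[OF W(3) a] show ?case
      by (intro exI[of _ ?W] exI[of _ "u @ a"]) auto
  qed
  then obtain W u where "finite W" "W \<subseteq> directed_cycles G j" "?disj (insert u W)" "P - {a} \<subset> W"
    "C \<subseteq> generated_walks W" by auto
  moreover have "?disj W"
    using \<open>?disj (insert u W)\<close> by (rule disjoint_family_on_mono[rotated]) auto
  ultimately show ?thesis by blast
qed

section \<open>Self-similar subsystems\<close>

lemma self_similar_system_of_cycles:
  assumes j: "j \<in> verts G" and W: "finite W" "W \<noteq> {}" "W \<subseteq> directed_cycles G j"
    "disjoint_family_on (\<lambda>p. S p ` K j) W"
  shows "\<exists>r' T' v' K'. ss_ifs (card W) r' T' \<and> ss_attractor (card W) r' T' v' K' \<and>
      strong_separation (card W) r' T' v' K' \<and> K' \<subseteq> K j \<and>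
      transformation_group (card W) T' = generate orthogonal_group (path_matrix T ` W) \<and>
      (\<forall>t. (\<Sum>i=1..card W. r' i powr t) = (\<Sum>w\<in>W. ratio w powr t))"
proof -
  obtain h where h: "bij_betw h {1..card W} W"
    using ex_bij_betw_nat_finite_1[OF W(1)] by blast
  let ?m = "card W"
  let ?r = "\<lambda>i. ratio (h i)" and ?T = "\<lambda>i. path_matrix T (h i)" and ?v = "\<lambda>i. S (h i) 0"
  have hW: "h i \<in> W" if "i \<in> {1..?m}" for i using h that by (auto simp: bij_betw_def)
  have h_walk: "set (h i) \<subseteq> arcs G" "h i \<noteq> []" "h i \<in> directed_cycles G j" if "i \<in> {1..?m}" for i
    using hW[OF that] W(3) by (auto simp: directed_cycles_def awalk_def)
  have sim: "similarity_map (?r i) (?T i) (?v i) = S (h i)" for i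
    by (rule ext) (rule path_map_eq_similarity_map[symmetric])
  have ifs: "ss_ifs ?m ?r ?T"
    unfolding ss_ifs_def using path_data h_walk by blast
  have "?m \<noteq> 0" using W by simp
  then have ne: "{1..?m} \<noteq> {}" by auto
  have cont: "continuous_on UNIV (S p)" for p
  proof -
    have "S p = similarity_map (ratio p) (path_matrix T p) (S p 0)"
      by (rule ext) (rule path_map_eq_similarity_map)
    then show ?thesis by (metis continuous_on_similarity_map)
  qed
  obtain K' where K': "K' \<noteq> {}" "compact K'" "K' \<subseteq> K j" "K' = (\<Union>i\<in>{1..?m}. S (h i) ` K')"
  proof (rule self_similar_subset_exists[of "{1..?m}" "K j" "\<lambda>i. S (h i)"])
    show "inj (S (h i))" "S (h i) ` K j \<subseteq> K j" if "i \<in> {1..?m}" for i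
      using inj_S[OF h_walk(1)[OF that]] cycle_image_subset[OF h_walk(3)[OF that]] .
    fix C assume "C \<noteq> {}" "compact C" "C \<subseteq> K j" "C = (\<Union>i\<in>{1..?m}. S (h i) ` C)"
    then show thesis by (rule that)
  qed (rule finite_atLeastAtMost ne compact_K[OF j] K_ne[OF j] cont)+
  have attr: "ss_attractor ?m ?r ?T ?v K'"
    unfolding ss_attractor_def sim by (intro conjI K'(1,2,4))
  have "strong_separation ?m ?r ?T ?v K'"
    unfolding strong_separation_def sim disjoint_family_on_def
  proof (intro ballI impI)
    fix i i' assume i: "i \<in> {1..?m}" "i' \<in> {1..?m}" "i \<noteq> i'"
    then have "h i \<noteq> h i'" by (simp add: inj_on_eq_iff[OF bij_betw_imp_inj_on[OF h]])
    then have "S (h i) ` K j \<inter> S (h i') ` K j = {}"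
      by (rule disjoint_family_onD[OF W(4) hW[OF i(1)] hW[OF i(2)]])
    then show "S (h i) ` K' \<inter> S (h i') ` K' = {}" using K'(3) by blast
  qed
  moreover have "?T ` {1..?m} = path_matrix T ` W"
    using bij_betw_imp_surj_on[OF h] by (auto simp: image_image[symmetric])
  then have "transformation_group ?m ?T = generate orthogonal_group (path_matrix T ` W)"
    by (simp add: transformation_group_def)
  moreover have "(\<Sum>i=1..?m. ?r i powr t) = (\<Sum>w\<in>W. ratio w powr t)" for t
    by (rule sum.reindex_bij_betw[OF h])
  ultimately show ?thesis
    using ifs attr K'(3)
    by (intro exI[of _ ?r] exI[of _ ?T] exI[of _ ?v] exI[of _ K'] conjI allI)
qed

lemma two_points_everywhere:
  assumes "i \<in> verts G" "j \<in> verts G" "x \<in> K i" "y \<in> K i" "x \<noteq> y"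
  shows "\<exists>x\<in>K j. \<exists>y\<in>K j. x \<noteq> y"
proof -
  obtain p where p: "awalk j p i"
    using walk_exists[OF assms(2,1)] by blast
  then have "S p x \<noteq> S p y"
    using assms(5) inj_S[of p] by (auto simp: awalk_def dest: injD)
  then show ?thesis using S_image_subset[OF p] assms(3,4) by blast
qed

lemma generated_group_eq:
  assumes W: "W \<subseteq> directed_cycles G j" and C: "C \<subseteq> generated_walks W"
    and all: "directed_cycles G j \<subseteq> generated_walks C"
  shows "generate orthogonal_group (path_matrix T ` W) = gd_transformation_group G T j"
proof
  interpret O: group "orthogonal_group :: (real^'n^'n) monoid" by (rule group_orthogonal_group)
  show "generate orthogonal_group (path_matrix T ` W) \<subseteq> gd_transformation_group G T j"
    unfolding gd_transformation_group_def using W by (intro O.mono_generate image_mono)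
  have sub: "subgroup (generate orthogonal_group (path_matrix T ` W)) orthogonal_group"
    using W directed_cycles_lists by (intro generate_subgroup) blast
  have "path_matrix T ` C \<subseteq> generate orthogonal_group (path_matrix T ` W)"
    using C by (auto simp: generated_walks_def)
  then have "generate orthogonal_group (path_matrix T ` C)
      \<subseteq> generate orthogonal_group (path_matrix T ` W)"
    by (rule O.generate_subgroup_incl[OF _ sub])
  then have "path_matrix T ` directed_cycles G j \<subseteq> generate orthogonal_group (path_matrix T ` W)"
    using all by (auto simp: generated_walks_def)
  then show "gd_transformation_group G T j \<subseteq> generate orthogonal_group (path_matrix T ` W)"
    unfolding gd_transformation_group_def by (rule O.generate_subgroup_incl[OF _ sub])
qed

text \<open>
  The cycles carrying the dimension and the cycles adjusting the group are combined in \<open>W\<close>; adding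
  cycles to a disjoint family only increases the sum that bounds the dimension.
\<close>

lemma self_similar_approximation:
  assumes j: "j \<in> verts G" and xy: "x \<in> K j" "y \<in> K j" "x \<noteq> y" and "\<epsilon> > 0"
  shows "\<exists>m r' T' v' K'. ss_ifs m r' T' \<and> ss_attractor m r' T' v' K' \<and>
      strong_separation m r' T' v' K' \<and> K' \<subseteq> K j \<and>
      hausdorff_dim (K j) - \<epsilon> < hausdorff_dim K' \<and>
      transformation_group m T' = gd_transformation_group G T j"
proof -
  \<comment> \<open>If \<open>\<epsilon>\<close> is large compared with the dimension, any two disjoint cycles will do, hence \<open>t = 0\<close>.\<close>
  define t where "t = max 0 (hausdorff_dim (K j) - \<epsilon> / 2)"
  have t: "t = 0 \<or> 0 < t \<and> t < hausdorff_dim (K j)" "hausdorff_dim (K j) - \<epsilon> < t"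
    using \<open>\<epsilon> > 0\<close> by (auto simp: t_def)
  obtain P where P: "finite P" "P \<subseteq> directed_cycles G j" "disjoint_family_on (\<lambda>p. S p ` K j) P"
    "2 \<le> card P" and sum: "\<forall>a\<in>P. 1 \<le> (\<Sum>p\<in>P - {a}. ratio p powr t)"
    by (rule disjoint_cycles_of_large_sum[OF j xy t(1)])
  have "\<not> card P \<le> Suc 0" using P(4) by simp
  then obtain a b where ab: "a \<in> P" "b \<in> P" "a \<noteq> b"
    using card_le_Suc0_iff_eq[OF P(1)] by blast
  obtain C where C: "finite C" "C \<subseteq> directed_cycles G j" "directed_cycles G j \<subseteq> generated_walks C"
    by (rule finitely_many_generating_cycles[OF j])
  obtain W where W: "finite W" "W \<subseteq> directed_cycles G j" "disjoint_family_on (\<lambda>p. S p ` K j) W"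
    "P - {a} \<subset> W" "C \<subseteq> generated_walks W"
    using disjoint_cycles_with_generators[OF j P(1,2,3) ab C(1,2)] by blast
  have "b \<in> W" using ab W(4) by blast
  then have "W \<noteq> {}" by blast
  then obtain r' T' v' K' where K': "ss_ifs (card W) r' T'" "ss_attractor (card W) r' T' v' K'"
    "strong_separation (card W) r' T' v' K'" "K' \<subseteq> K j"
    "transformation_group (card W) T' = generate orthogonal_group (path_matrix T ` W)"
    "\<forall>t. (\<Sum>i=1..card W. r' i powr t) = (\<Sum>w\<in>W. ratio w powr t)"
    using self_similar_system_of_cycles[OF j W(1) _ W(2,3)] by blast
  have "1 \<le> (\<Sum>p\<in>P - {a}. ratio p powr t)" using sum ab(1) by blast
  also have "\<dots> \<le> (\<Sum>w\<in>W. ratio w powr t)"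
    using W(1,4) by (intro sum_mono2) auto
  finally have sum_W: "1 \<le> (\<Sum>i=1..card W. r' i powr t)" using K'(6) by simp
  obtain u where u: "0 \<le> u" "hausdorff_measure u (K j) = 0"
    by (rule hausdorff_measure_K_vanishes[OF j])
  then have u': "hausdorff_measure u K' = 0"
    using hausdorff_measure_mono[OF K'(4), of u] by simp
  have "1 \<le> card (P - {a})" using P(1,4) ab(1) by simp
  then have "2 \<le> card W" using psubset_card_mono[OF W(1,4)] by simp
  then have "t \<le> hausdorff_dim K'"
    using sum_W u(1) u' by (intro le_hausdorff_dim_strongly_separated[OF K'(1-3)])
  then have "hausdorff_dim (K j) - \<epsilon> < hausdorff_dim K'" using t(2) by simp
  moreover have "transformation_group (card W) T' = gd_transformation_group G T j"
    unfolding K'(5) by (rule generated_group_eq[OF W(2,5) C(3)])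
  ultimately show ?thesis
    using K'(1-4) by (intro exI[of _ "card W"] exI[of _ r'] exI[of _ T'] exI[of _ v'] exI[of _ K'] conjI)
qed

end

theorem theorem1p1:
  fixes G :: "(nat, 'e) pre_digraph"
    and q j :: nat
    and r :: "'e \<Rightarrow> real" and T :: "'e \<Rightarrow> real^'n^'n" and v :: "'e \<Rightarrow> real^'n"
    and K :: "nat \<Rightarrow> (real^'n) set"
    and \<epsilon> :: real
  assumes "gd_ifs q G r T"
    and "strongly_connected G"
    and "gd_attractor G r T v K"
    and "\<exists>i\<in>{1..q}. \<exists>x\<in>K i. \<exists>y\<in>K i. x \<noteq> y"
    and "j \<in> {1..q}"
    and "\<epsilon> > 0"
  shows "\<exists>(m::nat) (r' :: nat \<Rightarrow> real) (T' :: nat \<Rightarrow> real^'n^'n) (v' :: nat \<Rightarrow> real^'n)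
           (K' :: (real^'n) set).
           ss_ifs m r' T' \<and> ss_attractor m r' T' v' K' \<and> strong_separation m r' T' v' K' \<and>
           K' \<subseteq> K j \<and>
           hausdorff_dim (K j) - \<epsilon> < hausdorff_dim K' \<and>
           dense_subset_of (transformation_group m T') (gd_transformation_group G T j)"
proof -
  have fin: "fin_digraph G" and verts: "verts G = {1..q}"
    and data: "\<forall>e\<in>arcs G. contracting_similarity_data (r e) (T e)"
    using assms(1) by (auto simp: gd_ifs_def)
  interpret gd_system G r T v K
    using fin data assms(2,3) by (simp add: gd_system_def gd_system_axioms_def)
  have j: "j \<in> verts G" using assms(5) verts by simp
  obtain i x y where "i \<in> verts G" "x \<in> K i" "y \<in> K i" "x \<noteq> y" using assms(4) verts by blast
  then obtain x y where "x \<in> K j" "y \<in> K j" "x \<noteq> y" using two_points_everywhere[OF _ j] by blast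
  then have "\<exists>m r' T' v' K'. ss_ifs m r' T' \<and> ss_attractor m r' T' v' K' \<and>
      strong_separation m r' T' v' K' \<and> K' \<subseteq> K j \<and>
      hausdorff_dim (K j) - \<epsilon> < hausdorff_dim K' \<and>
      transformation_group m T' = gd_transformation_group G T j"
    using self_similar_approximation[OF j _ _ _ \<open>\<epsilon> > 0\<close>] by blast
  then obtain m r' T' v' K' where *: "ss_ifs m r' T'" "ss_attractor m r' T' v' K'"
    "strong_separation m r' T' v' K'" "K' \<subseteq> K j" "hausdorff_dim (K j) - \<epsilon> < hausdorff_dim K'"
    and eq: "transformation_group m T' = gd_transformation_group G T j" by blast
  have "dense_subset_of (transformation_group m T') (gd_transformation_group G T j)"
    unfolding dense_subset_of_def eq using closure_subset by blast
  with * show ?thesis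
    by (intro exI[of _ m] exI[of _ r'] exI[of _ T'] exI[of _ v'] exI[of _ K'] conjI)
qed

end
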